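(* Let $\vec a,\vec b,\vec c\in\mathbb{R}^2$. Then the following are equivalent: (1) $S_{\vec a,\vec b,\vec c}$ is bounded from $L^\infty(T_B\times T_B)$ to $L^\infty(T_B\times T_B)$; (2) $T_{\vec a,\vec b,\vec c}$ is bounded from $L^\infty(T_B\times T_B)$ to $L^\infty(T_B\times T_B)$; (3) for each $i\in\{1,2\}$: $a_i>0$, $b_i>-1$, and $c_i=n+1+a_i+b_i$.
   Context: Let $n$ be a positive integer. For $z=(z_1,\dots,z_n)\in\mathbb{C}^n$ write $z=x+iy$ with $x,y\in\mathbb{R}^n$, $z'=(z_1,\dots,z_{n-1})$, $y'=(y_1,\dots,y_{n-1})$. Let $B=\{y\in\mathbb{R}^n: |y'|^2<y_n\}$ and $T_B=\{x+iy: x\in\mathbb{R}^n, y\in B\}$. For $z\in T_B$ put $\rho(z)=y_n-|y'|^2>0$, and for $z,u\in T_B$ put $\rho(z,u)=\frac14\big(\sum_{j=1}^{n-1}(z_j-\overline{u_j})^2-2i(z_n-\overline{u_n})\big)$; this has positive real part, and complex powers $\rho(z,u)^c$ are taken with the principal branch. $dV$ is Lebesgue measure on $\mathbb{C}^n$. $L^\infty(T_B\times T_B)$ is the space of essentially bounded measurable functions on $T_B\times T_B$. For $\vec a=(a_1,a_2),\vec b=(b_1,b_2),\vec c=(c_1,c_2)\in\mathbb{R}^2$, $T_{\vec a,\vec b,\vec c}f(z,w)=\rho(z)^{a_1}\rho(w)^{a_2}\int_{T_B}\int_{T_B}\frac{\rho(u)^{b_1}\rho(\eta)^{b_2}}{\rho(z,u)^{c_1}\rho(w,\eta)^{c_2}}f(u,\eta)\,dV(u)\,dV(\eta)$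 and $S_{\vec a,\vec b,\vec c}f(z,w)=\rho(z)^{a_1}\rho(w)^{a_2}\int_{T_B}\int_{T_B}\frac{\rho(u)^{b_1}\rho(\eta)^{b_2}}{|\rho(z,u)|^{c_1}|\rho(w,\eta)|^{c_2}}f(u,\eta)\,dV(u)\,dV(\eta)$. An operator is bounded from $X$ to $Y$ if for every $f\in X$ the defining integral converges for a.e. $(z,w)$ and $\|Tf\|_Y\le C\|f\|_X$ with $C$ independent of $f$. *)

theory Defs
  imports "HOL-Analysis.Analysis"
begin

text \<open>Points of C^n are modelled as complex^'n for a finite linearly ordered index
type 'n with n = CARD('n); the largest index plays the role of the last coordinate.\<close>

type_synonym 'n pt = "(complex^'n) \<times> (complex^'n)"

definition lastidx :: "'n::{finite,linorder}" where
  "lastidx = Max UNIV"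

definition rho :: "complex^'n::{finite,linorder} \<Rightarrow> real" where
  "rho z = Im (z$lastidx) - (\<Sum>j\<in>UNIV - {lastidx}. (Im (z$j))^2)"

definition TB :: "(complex^'n::{finite,linorder}) set" where
  "TB = {z. rho z > 0}"

definition rho2 :: "complex^('n::{finite,linorder}) \<Rightarrow> complex^('n::{finite,linorder}) \<Rightarrow> complex" where
  "rho2 z u = (1/4) * ((\<Sum>j\<in>UNIV - {lastidx}. (z$j - cnj (u$j))^2)
                        - 2 * \<i> * (z$lastidx - cnj (u$lastidx)))"

definition Om :: "('n::{finite,linorder}) pt set" where
  "Om = TB \<times> TB"

definition Mpair :: "('n::{finite,linorder}) pt measure" where
  "Mpair = lborel \<Otimes>\<^sub>M lborel"

definition pref :: "real \<Rightarrow> real \<Rightarrow> ('n::{finite,linorder}) pt \<Rightarrow> real" where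
  "pref a1 a2 x = (case x of (z, w) \<Rightarrow> rho z powr a1 * rho w powr a2)"

definition kerT :: "real \<Rightarrow> real \<Rightarrow> real \<Rightarrow> real \<Rightarrow> ('n::{finite,linorder}) pt \<Rightarrow> 'n pt \<Rightarrow> complex" where
  "kerT b1 b2 c1 c2 x p = (case x of (z, w) \<Rightarrow> case p of (u, \<eta>) \<Rightarrow>
      complex_of_real (rho u powr b1 * rho \<eta> powr b2)
      / (rho2 z u powr complex_of_real c1 * rho2 w \<eta> powr complex_of_real c2))"

definition kerS :: "real \<Rightarrow> real \<Rightarrow> real \<Rightarrow> real \<Rightarrow> ('n::{finite,linorder}) pt \<Rightarrow> 'n pt \<Rightarrow> complex" where
  "kerS b1 b2 c1 c2 x p = (case x of (z, w) \<Rightarrow> case p of (u, \<eta>) \<Rightarrow>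
      complex_of_real (rho u powr b1 * rho \<eta> powr b2
      / (cmod (rho2 z u) powr c1 * cmod (rho2 w \<eta>) powr c2)))"

definition kernel_op :: "(('n::{finite,linorder}) pt \<Rightarrow> real) \<Rightarrow> ('n pt \<Rightarrow> 'n pt \<Rightarrow> complex)
    \<Rightarrow> ('n pt \<Rightarrow> complex) \<Rightarrow> 'n pt \<Rightarrow> complex" where
  "kernel_op P K f x = complex_of_real (P x) * set_lebesgue_integral Mpair Om (\<lambda>p. K x p * f p)"

text \<open>Boundedness L^infty(T_B x T_B) -> L^infty(T_B x T_B): for every essentially bounded
  measurable f (with a.e. bound M0 on T_B x T_B, i.e. any M0 >= ||f||_infty), the defining integral
  converges absolutely for a.e. (z,w), the result is measurable and essentially bounded by C*M0.\<close>
definition bounded_Linf :: "(('n::{finite,linorder}) pt \<Rightarrow> real) \<Rightarrow> ('n pt \<Rightarrow> 'n pt \<Rightarrow> complex) \<Rightarrow> bool" where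
  "bounded_Linf P K \<longleftrightarrow> (\<exists>C::real. \<forall>(f::'n pt \<Rightarrow> complex) (M0::real).
     f \<in> borel_measurable Mpair \<longrightarrow> (AE p in Mpair. p \<in> Om \<longrightarrow> cmod (f p) \<le> M0) \<longrightarrow>
       (AE x in Mpair. x \<in> Om \<longrightarrow> set_integrable Mpair Om (\<lambda>p. K x p * f p))
     \<and> (\<lambda>x. indicator Om x *\<^sub>R kernel_op P K f x) \<in> borel_measurable Mpair
     \<and> (AE x in Mpair. x \<in> Om \<longrightarrow> cmod (kernel_op P K f x) \<le> C * M0))"

end

theory Submission
  imports Defs
begin

text \<open>
  A measure preserving shear turns the integral of
  \<open>\<rho>(u)\<^sup>b / |\<rho>(z,u)|\<^sup>c\<close> over \<open>T\<^sub>B\<close> into iterated one-dimensional integrals, and scaling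
  evaluates it exactly as \<open>k \<rho>(z)\<close> to the power \<open>n + 1 + b - c\<close>, where the constant
  \<open>k > 0\<close> is finite iff \<open>b > -1\<close> and \<open>c > n + 1 + b\<close>. The kernel of \<open>S\<close> is the modulus of the
  kernel of \<open>T\<close>, so the conditions imply boundedness of both operators. Conversely,
  the test function \<open>1\<close> forces \<open>k\<close> to be finite. Testing with the conjugate phase of the kernel
  frozen at a point \<open>x\<^sub>0\<close> recovers, up to a factor \<open>2\<close>, the integral of the modulus at all points near
  \<open>x\<^sub>0\<close> simultaneously, so \<open>\<rho>\<close> to the power \<open>a + n + 1 + b - c\<close> is bounded and this exponent
  vanishes.
\<close>

section \<open>One-dimensional integrals\<close>

lemma nn_integral_inverse_Icc:
  assumes "0 < a" "a \<le> (b::real)"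
  shows "(\<integral>\<^sup>+x. ennreal (1/x) * indicator {a..b} x \<partial>lborel) = ennreal (ln b - ln a)"
  using assms by (intro nn_integral_FTC_Icc) (auto intro!: derivative_eq_intros simp: divide_inverse)

text \<open>The logarithm is unbounded: if \<open>I\<close> were a real r, the choice ln N = (r +
  1)/e would give r + 1 \<le> r.\<close>

lemma ennreal_eq_top_if_ge_ln:
  assumes "\<And>N. N \<ge> 1 \<Longrightarrow> I \<ge> ennreal (e * ln N)" "e > 0"
  shows "I = (\<infinity>::ennreal)"
proof (rule ccontr)
  assume "I \<noteq> \<infinity>"
  then obtain r where r: "I = ennreal r" "r \<ge> 0"
    by (cases I) auto
  have "ennreal (e * ln (exp ((r+1)/e))) \<le> I"
    using assms(1)[of "exp ((r+1)/e)"] r assms(2) by simp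
  then show False
    using r assms(2) by simp
qed

lemma nn_integral_eq_top_at_infinity:
  assumes [measurable]: "f \<in> borel_measurable borel" and "e > 0"
    and f: "\<And>x. x \<ge> 1 \<Longrightarrow> ennreal (e / x) \<le> f x"
  shows "(\<integral>\<^sup>+x. f x \<partial>lborel) = \<infinity>"
proof (rule ennreal_eq_top_if_ge_ln[OF _ \<open>e > 0\<close>])
  fix N :: real assume N: "N \<ge> 1"
  have "ennreal (e * ln N) = ennreal e * (\<integral>\<^sup>+x. ennreal (1/x) * indicator {1..N} x \<partial>lborel)"
    using nn_integral_inverse_Icc[of 1 N] N \<open>e > 0\<close> by (simp add: ennreal_mult)
  also have "\<dots> = (\<integral>\<^sup>+x. ennreal e * (ennreal (1/x) * indicator {1..N} x) \<partial>lborel)"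
    by (rule nn_integral_cmult[symmetric]) simp
  also have "\<dots> \<le> (\<integral>\<^sup>+x. f x \<partial>lborel)"
    using f \<open>e > 0\<close> by (intro nn_integral_mono) (auto simp: indicator_def ennreal_mult[symmetric])
  finally show "ennreal (e * ln N) \<le> (\<integral>\<^sup>+x. f x \<partial>lborel)" .
qed

lemma nn_integral_eq_top_at_0:
  assumes [measurable]: "f \<in> borel_measurable borel" and "e > 0"
    and f: "\<And>x. 0 < x \<Longrightarrow> x \<le> 1 \<Longrightarrow> ennreal (e / x) \<le> f x"
  shows "(\<integral>\<^sup>+x. f x \<partial>lborel) = \<infinity>"
proof (rule ennreal_eq_top_if_ge_ln[OF _ \<open>e > 0\<close>])
  fix N :: real assume N: "N \<ge> 1"
  \<comment> \<open>The interval from 1/N to 1 carries the same logarithmic mass ln N as the one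
    from 1 to N, so one criterion settles divergence at 0 and at infinity.\<close>
  have "ennreal (e * ln N) = ennreal e * (\<integral>\<^sup>+x. ennreal (1/x) * indicator {1/N..1} x \<partial>lborel)"
    using nn_integral_inverse_Icc[of "1/N" 1] N \<open>e > 0\<close> by (simp add: ennreal_mult ln_div)
  also have "\<dots> = (\<integral>\<^sup>+x. ennreal e * (ennreal (1/x) * indicator {1/N..1} x) \<partial>lborel)"
    by (rule nn_integral_cmult[symmetric]) simp
  also have "\<dots> \<le> (\<integral>\<^sup>+x. f x \<partial>lborel)"
  proof (intro nn_integral_mono)
    fix x :: real
    have "0 < x" if "1/N \<le> x" using that N by (smt (verit) divide_pos_pos)
    then show "ennreal e * (ennreal (1/x) * indicator {1/N..1} x) \<le> f x"
      using f[of x] \<open>e > 0\<close> by (auto simp: indicator_def ennreal_mult[symmetric])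
  qed
  finally show "ennreal (e * ln N) \<le> (\<integral>\<^sup>+x. f x \<partial>lborel)" .
qed

section \<open>Convergence of the one-dimensional model integrals\<close>

lemma nn_integral_powr_from_0_finite:
  assumes "s > -1"
  shows "(\<integral>\<^sup>+x. ennreal (x powr s) * indicator {0..1} x \<partial>lborel) < \<infinity>"
  using nn_integral_has_integral_lebesgue[OF _ has_integral_powr_from_0[of s 1]] assms
  by (simp add: mult.commute nn_integral_set_ennreal)

lemma nn_integral_powr_to_inf_finite:
  assumes "s < -1"
  shows "(\<integral>\<^sup>+x. ennreal (x powr s) * indicator {1..} x \<partial>lborel) < \<infinity>"
  using nn_integral_has_integral_lebesgue[OF _ has_integral_powr_to_inf[of s 1]] assms
  by (simp add: mult.commute nn_integral_set_ennreal)

text \<open>For p > 1/2 this is the Beta value B(1/2, p - 1/2). It stays in the extended nonnegative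
  reals because only positivity and finiteness matter.\<close>

definition kappa_integral :: "real \<Rightarrow> ennreal" where
  "kappa_integral p = (\<integral>\<^sup>+x. ennreal ((1 + x\<^sup>2) powr (-p)) \<partial>lborel)"

text \<open>In the convergent range this is B(b + 1, c - b - 2). The exponent 1 - c is what remains
  of -c once the last real part has been integrated out.\<close>

definition beta_integral :: "real \<Rightarrow> real \<Rightarrow> ennreal" where
  "beta_integral b c = (\<integral>\<^sup>+x. ennreal (x powr b * (1 + x) powr (1 - c)) * indicator {0<..} x \<partial>lborel)"

text \<open>Only the tails matter: at the borderline p = 1/2 the integrand decays like 1/x, and for
  larger p it is dominated by \<open>x powr (-2*p)\<close>.\<close>

lemma kappa_integral_finite_iff: "kappa_integral p < \<infinity> \<longleftrightarrow> p > 1/2"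
proof
  assume fin: "kappa_integral p < \<infinity>"
  show "p > 1/2"
  proof (rule ccontr)
    assume p: "\<not> p > 1/2"
    have "kappa_integral p = \<infinity>"
      unfolding kappa_integral_def
    proof (rule nn_integral_eq_top_at_infinity[of _ "1/2"])
      fix x :: real assume x: "x \<ge> 1"
      have "1 / 2 / x \<le> 1 / sqrt (1 + x\<^sup>2)"
      proof -
        have "1 \<le> x\<^sup>2" using x by simp
        then have "sqrt (1 + x\<^sup>2) \<le> sqrt ((2*x)\<^sup>2)"
          by (intro real_sqrt_le_mono) (simp add: power_mult_distrib)
        also have "\<dots> = 2 * x" using x by (subst real_sqrt_abs) simp
        finally have "sqrt (1 + x\<^sup>2) \<le> 2 * x" .
        moreover have "sqrt (1 + x\<^sup>2) > 0" by (simp add: add_pos_nonneg)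
        ultimately have "1 / (2 * x) \<le> 1 / sqrt (1 + x\<^sup>2)"
          by (intro divide_left_mono) (use x in auto)
        then show ?thesis by simp
      qed
      also have "\<dots> = (1 + x\<^sup>2) powr (-(1/2))"
        by (simp add: powr_minus_divide powr_half_sqrt)
      also have "\<dots> \<le> (1 + x\<^sup>2) powr (-p)"
        using p by (intro powr_mono) auto
      finally show "ennreal (1 / 2 / x) \<le> ennreal ((1 + x\<^sup>2) powr (-p))"
        by (rule ennreal_leI)
    qed auto
    with fin show False by simp
  qed
next
  assume p: "p > 1/2"
  \<comment> \<open>A majorant for x > 0; by evenness its reflection serves for x < 0. The constant
    1 is written as \<open>x powr 0\<close> to fit the lemma on powers near 0.\<close>
  let ?f = "\<lambda>x::real. ennreal (x powr 0) * indicator {0..1} x + ennreal (x powr (-2*p)) * indicator {1..} x"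
  have le: "ennreal ((1 + x\<^sup>2) powr (-p)) \<le> ?f x" if x: "x > 0" for x
  proof (cases "x \<le> 1")
    case True
    have "(1 + x\<^sup>2) powr (-p) \<le> (1 + x\<^sup>2) powr 0"
      using p by (intro powr_mono) auto
    then show ?thesis using True x
      by (auto intro!: add_increasing2 simp: ennreal_le_1 split: if_splits)
  next
    case False
    have "(1 + x\<^sup>2) powr (-p) \<le> (x\<^sup>2) powr (-p)"
      using p False by (intro powr_mono2') auto
    also have "\<dots> = x powr (-2*p)"
      using x by (simp add: powr_numeral[symmetric] powr_powr del: powr_numeral)
    finally show ?thesis using False x
      by (auto intro!: ennreal_leI)
  qed
  have "kappa_integral p \<le> (\<integral>\<^sup>+x. ?f x + ?f (0 + (-1) * x) \<partial>lborel)"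
    unfolding kappa_integral_def
  proof (rule nn_integral_mono_AE)
    \<comment> \<open>The point 0 is dropped because \<open>0 powr 0\<close> is 0, so the majorant
      vanishes there while the integrand is 1.\<close>
    have "AE x in lborel. x \<noteq> (0::real)" by (rule AE_lborel_singleton)
    then show "AE x in lborel. ennreal ((1 + x\<^sup>2) powr (-p)) \<le> ?f x + ?f (0 + (-1) * x)"
    proof eventually_elim
      case (elim x)
      show ?case
      proof (cases "x > 0")
        case True
        show ?thesis by (rule order_trans[OF le[OF True] add_increasing2[OF zero_le order_refl]])
      next
        case False
        then have "ennreal ((1 + x\<^sup>2) powr (-p)) \<le> ?f (0 + (-1) * x)"
          using le[of "-x"] elim by simp
        then show ?thesis by (rule order_trans[OF _ add_increasing[OF zero_le order_refl]])
      qed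
    qed
  qed
  also have "\<dots> = (\<integral>\<^sup>+x. ?f x \<partial>lborel) + (\<integral>\<^sup>+x. ?f (0 + (-1) * x) \<partial>lborel)"
    by (rule nn_integral_add) auto
  also have "(\<integral>\<^sup>+x. ?f (0 + (-1) * x) \<partial>lborel) = (\<integral>\<^sup>+x. ?f x \<partial>lborel)"
    by (subst (2) nn_integral_real_affine[where c="-1" and t=0]) (auto simp del: mult_minus1)
  also have "(\<integral>\<^sup>+x. ?f x \<partial>lborel) = (\<integral>\<^sup>+x. ennreal (x powr 0) * indicator {0..1} x \<partial>lborel)
      + (\<integral>\<^sup>+x. ennreal (x powr (-2*p)) * indicator {1..} x \<partial>lborel)"
    by (rule nn_integral_add) auto
  also have "\<dots> + \<dots> < \<infinity>"
    using nn_integral_powr_from_0_finite[of 0] nn_integral_powr_to_inf_finite[of "-2*p"] p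
    by (simp add: less_top)
  finally show "kappa_integral p < \<infinity>" .
qed

text \<open>A nonempty open set is not a null set. This later turns almost-everywhere bounds into
  bounds at some point near a prescribed one.\<close>

lemma AE_lborel_open_imp_ex:
  assumes "AE x in lborel. P x" "open S" "S \<noteq> {}"
  shows "\<exists>x\<in>S. P x"
proof (rule ccontr)
  assume "\<not> (\<exists>x\<in>S. P x)"
  with assms(1) have "AE x in lborel. x \<notin> S"
    by (auto elim: eventually_mono)
  then have "S \<in> null_sets lborel"
    using \<open>open S\<close> by (subst AE_iff_null_sets) auto
  then show False
    using open_not_negligible[OF assms(2,3)] by (auto simp: negligible_iff_null_sets null_sets_completionI)
qed

lemma nn_integral_lborel_pos:
  fixes f :: "'a::euclidean_space \<Rightarrow> ennreal"
  assumes [measurable]: "f \<in> borel_measurable borel" and "open S" "S \<noteq> {}"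
    and pos: "\<And>x. x \<in> S \<Longrightarrow> 0 < f x"
  shows "0 < (\<integral>\<^sup>+x. f x \<partial>lborel)"
proof (rule ccontr)
  assume "\<not> 0 < (\<integral>\<^sup>+x. f x \<partial>lborel)"
  then have "AE x in lborel. f x = 0"
    by (subst nn_integral_0_iff_AE[symmetric]) (auto simp: zero_less_iff_neq_zero)
  from AE_lborel_open_imp_ex[OF this assms(2,3)] pos show False by force
qed

lemma kappa_integral_pos: "kappa_integral p > 0"
proof -
  have "(1 + x\<^sup>2) powr (-p) > 0" for x :: real
    by (auto simp: add_nonneg_eq_0_iff)
  then show ?thesis
    unfolding kappa_integral_def by (intro nn_integral_lborel_pos[of _ UNIV]) auto
qed

lemma beta_integral_pos: "beta_integral b c > 0"
  unfolding beta_integral_def by (rule nn_integral_lborel_pos[of _ "{0<..}"]) (auto simp: indicator_def)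

text \<open>Since c > 1, the power of 1 + x is decreasing: it lies between 2^(1-c) and 1 on (0,1],
  and between (2x)^(1-c) and x^(1-c) from 1 on. Behaviour at 0 then decides b > -1, behaviour at
  infinity c > b + 2.\<close>

lemma beta_integral_finite_iff:
  assumes c: "c > 1"
  shows "beta_integral b c < \<infinity> \<longleftrightarrow> b > -1 \<and> c > b + 2"
proof
  assume fin: "beta_integral b c < \<infinity>"
  let ?f = "\<lambda>x::real. ennreal (x powr b * (1 + x) powr (1 - c)) * indicator {0<..} x"
  have m: "?f \<in> borel_measurable borel" by auto
  have e: "(2::real) powr (1 - c) > 0" by simp
  have "b > -1"
  proof (rule ccontr)
    assume b: "\<not> b > -1"
    have "ennreal (2 powr (1 - c) / x) \<le> ?f x" if x: "0 < x" "x \<le> 1" for x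
    proof -
      have "x powr (-1) * 2 powr (1-c) \<le> x powr b * (1 + x) powr (1-c)"
        using x b c by (intro mult_mono powr_mono' powr_mono2') auto
      then show ?thesis using x by (auto intro!: ennreal_leI simp: powr_minus_divide)
    qed
    then have "beta_integral b c = \<infinity>"
      unfolding beta_integral_def by (rule nn_integral_eq_top_at_0[OF m e])
    with fin show False by simp
  qed
  moreover have "c > b + 2"
  proof (rule ccontr)
    assume b: "\<not> c > b + 2"
    have "ennreal (2 powr (1 - c) / x) \<le> ?f x" if x: "1 \<le> x" for x
    proof -
      have "2 powr (1-c) / x = 2 powr (1-c) * x powr (-1)"
        using x by (simp add: powr_minus_divide)
      also have "\<dots> \<le> 2 powr (1-c) * x powr (b + (1 - c))"
        using x b by (intro mult_left_mono powr_mono) auto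
      also have "\<dots> = x powr b * (2 * x) powr (1-c)"
        using x by (simp add: powr_add powr_mult)
      also have "\<dots> \<le> x powr b * (1 + x) powr (1-c)"
        using x c by (intro mult_left_mono powr_mono2') auto
      finally show ?thesis using x by (auto intro!: ennreal_leI)
    qed
    then have "beta_integral b c = \<infinity>"
      unfolding beta_integral_def by (rule nn_integral_eq_top_at_infinity[OF m e])
    with fin show False by simp
  qed
  ultimately show "b > -1 \<and> c > b + 2" by blast
next
  assume b: "b > -1 \<and> c > b + 2"
  have "beta_integral b c \<le> (\<integral>\<^sup>+x. ennreal (x powr b) * indicator {0..1} x
      + ennreal (x powr (b + (1 - c))) * indicator {1..} x \<partial>lborel)"
    unfolding beta_integral_def
  proof (rule nn_integral_mono)
    fix x :: real
    consider "x \<le> 0" | "0 < x" "x \<le> 1" | "x > 1" by linarith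
    then show "ennreal (x powr b * (1 + x) powr (1 - c)) * indicator {0<..} x
      \<le> ennreal (x powr b) * indicator {0..1} x + ennreal (x powr (b + (1 - c))) * indicator {1..} x"
    proof cases
      case 2
      have "(1 + x) powr (1 - c) \<le> 1 powr (1 - c)"
        using 2 c by (intro powr_mono2') auto
      then have "x powr b * (1 + x) powr (1 - c) \<le> x powr b"
        by (auto intro: mult_left_le)
      then show ?thesis using 2 by (auto intro!: add_increasing2 ennreal_leI)
    next
      case 3
      have "(1 + x) powr (1 - c) \<le> x powr (1 - c)"
        using 3 c by (intro powr_mono2') auto
      then have "x powr b * (1 + x) powr (1 - c) \<le> x powr (b + (1 - c))"
        using 3 by (auto intro!: mult_left_mono simp: powr_add)
      then show ?thesis using 3 by (auto intro!: ennreal_leI)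
    qed auto
  qed
  also have "\<dots> = (\<integral>\<^sup>+x. ennreal (x powr b) * indicator {0..1} x \<partial>lborel)
      + (\<integral>\<^sup>+x. ennreal (x powr (b + (1 - c))) * indicator {1..} x \<partial>lborel)"
    by (rule nn_integral_add) auto
  also have "\<dots> < \<infinity>"
    using nn_integral_powr_from_0_finite[of b] nn_integral_powr_to_inf_finite[of "b + (1-c)"] b
    by (simp add: less_top)
  finally show "beta_integral b c < \<infinity>" .
qed

section \<open>Affine substitutions, and squares integrated one variable at a time\<close>

lemma nn_integral_shifted_square:
  assumes A: "A > 0"
  shows "(\<integral>\<^sup>+y. ennreal ((A + (y - m)\<^sup>2 / 4) powr (-p)) \<partial>lborel)
    = 2 * kappa_integral p * ennreal (A powr (1/2 - p))"
proof -
  \<comment> \<open>Replacing y by m + 2 sqrt(A) y turns the base into A (1 + y^2); the Jacobian 2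
    sqrt(A) raises the exponent of A by 1/2.\<close>
  have "(\<integral>\<^sup>+y. ennreal ((A + (y - m)\<^sup>2 / 4) powr (-p)) \<partial>lborel)
      = ennreal \<bar>2 * sqrt A\<bar> * (\<integral>\<^sup>+y. ennreal ((A + (m + 2 * sqrt A * y - m)\<^sup>2 / 4) powr (-p)) \<partial>lborel)"
    using A by (intro nn_integral_real_affine) auto
  also have "(\<lambda>y. ennreal ((A + (m + 2 * sqrt A * y - m)\<^sup>2 / 4) powr (-p)))
      = (\<lambda>y. ennreal (A powr (-p)) * ennreal ((1 + y\<^sup>2) powr (-p)))"
  proof
    fix y
    have "A + (m + 2 * sqrt A * y - m)\<^sup>2 / 4 = A * (1 + y\<^sup>2)"
      using A by (simp add: power_mult_distrib algebra_simps)
    then show "ennreal ((A + (m + 2 * sqrt A * y - m)\<^sup>2 / 4) powr (-p))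
        = ennreal (A powr (-p)) * ennreal ((1 + y\<^sup>2) powr (-p))"
      using A by (simp add: powr_mult ennreal_mult)
  qed
  also have "(\<integral>\<^sup>+y. ennreal (A powr (-p)) * ennreal ((1 + y\<^sup>2) powr (-p)) \<partial>lborel)
      = ennreal (A powr (-p)) * kappa_integral p"
    unfolding kappa_integral_def by (rule nn_integral_cmult) auto
  also have "ennreal \<bar>2 * sqrt A\<bar> * (ennreal (A powr (-p)) * kappa_integral p)
      = 2 * kappa_integral p * (ennreal (sqrt A) * ennreal (A powr (-p)))"
    using A by (simp add: abs_mult ennreal_mult mult_ac)
  also have "ennreal (sqrt A) * ennreal (A powr (-p)) = ennreal (A powr (1/2 - p))"
    using A by (simp add: ennreal_mult[symmetric] powr_half_sqrt[symmetric] powr_add[symmetric])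
  finally show ?thesis .
qed

lemma nn_integral_half_line_beta:
  assumes A: "A > 0"
  shows "(\<integral>\<^sup>+t. ennreal ((t - m) powr b * (A + (t - m) / 2) powr (1 - c)) * indicator {m<..} t \<partial>lborel)
    = ennreal (2 powr (b + 1)) * beta_integral b c * ennreal (A powr (b + 2 - c))"
proof -
  \<comment> \<open>With t = m + 2 A x the factors become powers of A times powers of x and 1 + x;
    the exponents 1 (Jacobian), b and 1 - c of A add up.\<close>
  have "(\<integral>\<^sup>+t. ennreal ((t - m) powr b * (A + (t - m) / 2) powr (1 - c)) * indicator {m<..} t \<partial>lborel)
      = ennreal \<bar>2 * A\<bar> * (\<integral>\<^sup>+x. ennreal ((m + 2 * A * x - m) powr b * (A + (m + 2 * A * x - m) / 2) powr (1 - c))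
            * indicator {m<..} (m + 2 * A * x) \<partial>lborel)"
    using A by (intro nn_integral_real_affine) auto
  also have "(\<lambda>x. ennreal ((m + 2 * A * x - m) powr b * (A + (m + 2 * A * x - m) / 2) powr (1 - c))
            * indicator {m<..} (m + 2 * A * x))
      = (\<lambda>x. ennreal ((2 * A) powr b * A powr (1 - c)) *
             (ennreal (x powr b * (1 + x) powr (1 - c)) * indicator {0<..} x))"
  proof
    fix x
    have "ennreal ((m + 2 * A * x - m) powr b * (A + (m + 2 * A * x - m) / 2) powr (1 - c))
        = ennreal ((2 * A) powr b * A powr (1 - c)) * ennreal (x powr b * (1 + x) powr (1 - c))"
      if x: "x > 0"
    proof -
      have "A + (m + 2 * A * x - m) / 2 = A * (1 + x)" "m + 2 * A * x - m = (2 * A) * x"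
        by (simp_all add: algebra_simps)
      then show ?thesis
        using A x by (simp only: powr_mult) (simp add: ennreal_mult mult_ac)
    qed
    moreover have "m < m + 2 * A * x \<longleftrightarrow> 0 < x"
      using A by (simp add: zero_less_mult_iff)
    ultimately show "ennreal ((m + 2 * A * x - m) powr b * (A + (m + 2 * A * x - m) / 2) powr (1 - c))
            * indicator {m<..} (m + 2 * A * x)
      = ennreal ((2 * A) powr b * A powr (1 - c)) *
             (ennreal (x powr b * (1 + x) powr (1 - c)) * indicator {0<..} x)"
      by (cases "x > 0") auto
  qed
  also have "(\<integral>\<^sup>+x. ennreal ((2 * A) powr b * A powr (1 - c)) *
             (ennreal (x powr b * (1 + x) powr (1 - c)) * indicator {0<..} x) \<partial>lborel)
      = ennreal ((2 * A) powr b * A powr (1 - c)) * beta_integral b c"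
    unfolding beta_integral_def by (rule nn_integral_cmult) auto
  also have "ennreal \<bar>2 * A\<bar> * (ennreal ((2 * A) powr b * A powr (1 - c)) * beta_integral b c)
      = ennreal (2 * A * ((2 * A) powr b * A powr (1 - c))) * beta_integral b c"
    using A by (simp add: ennreal_mult mult_ac)
  also have "2 * A * ((2 * A) powr b * A powr (1 - c)) = 2 powr (b + 1) * A powr (b + 2 - c)"
  proof -
    have "2 * A * ((2 * A) powr b * A powr (1 - c)) = (2 * 2 powr b) * (A powr 1 * A powr b * A powr (1 - c))"
      using A by (simp add: powr_mult mult_ac)
    also have "A powr 1 * A powr b * A powr (1 - c) = A powr (1 + b + (1 - c))"
      by (simp only: powr_add)
    also have "1 + b + (1 - c) = b + 2 - c" by simp
    also have "2 * (2::real) powr b = 2 powr (b + 1)" by (simp add: powr_add)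
    finally show ?thesis .
  qed
  also have "ennreal (2 powr (b + 1) * A powr (b + 2 - c)) * beta_integral b c
      = ennreal (2 powr (b + 1)) * beta_integral b c * ennreal (A powr (b + 2 - c))"
    by (simp add: ennreal_mult mult_ac)
  finally show ?thesis .
qed

text \<open>The constant collected when k square variables are integrated out in turn, each of which
  lowers the exponent p by 1/2.\<close>

fun kappa_prod :: "nat \<Rightarrow> real \<Rightarrow> ennreal" where
  "kappa_prod 0 p = 1"
| "kappa_prod (Suc k) p = 2 * kappa_integral p * kappa_prod k (p - 1/2)"

lemma kappa_prod_pos: "kappa_prod k p > 0"
  by (induction k arbitrary: p) (auto simp: kappa_integral_pos ennreal_zero_less_mult_iff)

lemma kappa_prod_finite: "p > real k / 2 \<Longrightarrow> kappa_prod k p < \<infinity>"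
proof (induction k arbitrary: p)
  case (Suc k)
  then show ?case
    using Suc.IH[of "p - 1/2"] kappa_integral_finite_iff[of p] by (auto simp: ennreal_mult_less_top field_simps)
qed auto

text \<open>The factor with the smallest argument, p - k/2, gives the binding condition. The index
  is a successor because the empty product is finite for every p.\<close>

lemma kappa_prod_finiteD: "kappa_prod (Suc k) p < \<infinity> \<Longrightarrow> p > real (Suc k) / 2"
proof (induction k arbitrary: p)
  case 0
  then have "kappa_integral p < \<infinity>" by (auto simp: ennreal_mult_less_top)
  then show ?case by (simp add: kappa_integral_finite_iff[of p, simplified])
next
  case (Suc k)
  have "kappa_prod (Suc k) (p - 1/2) < \<infinity>"
  proof -
    \<comment> \<open>Positivity of the first factor matters: 0 times infinity is 0, so a finite
      product alone does not bound the other factor.\<close>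
    have "2 * kappa_integral p * kappa_prod (Suc k) (p - 1/2) < \<infinity>" "2 * kappa_integral p > 0"
      using Suc.prems kappa_integral_pos[of p] by (auto simp: ennreal_zero_less_mult_iff)
    then show ?thesis unfolding ennreal_mult_less_top infinity_ennreal_def by auto
  qed
  from Suc.IH[OF this] show ?case by (simp add: field_simps)
qed

text \<open>For each single integration the squares of the other coordinates join A as the constant;
  the induction hypothesis then applies with p - 1/2.\<close>

lemma nn_integral_PiM_sum_squares:
  fixes m :: "'i \<Rightarrow> real"
  assumes "finite I" "A > 0"
  shows "(\<integral>\<^sup>+w. ennreal ((A + (\<Sum>i\<in>I. (w i - m i)\<^sup>2) / 4) powr (-p)) \<partial>Pi\<^sub>M I (\<lambda>_. lborel))
     = kappa_prod (card I) p * ennreal (A powr (real (card I) / 2 - p))"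
  using assms
proof (induction I arbitrary: p rule: finite_induct)
  case empty
  interpret product_sigma_finite "\<lambda>_::'i. lborel::real measure" ..
  show ?case by (simp add: space_PiM_empty)
next
  case (insert i I)
  interpret product_sigma_finite "\<lambda>_::'i. lborel::real measure" ..
  have "(\<integral>\<^sup>+w. ennreal ((A + (\<Sum>j\<in>insert i I. (w j - m j)\<^sup>2) / 4) powr (-p)) \<partial>Pi\<^sub>M (insert i I) (\<lambda>_. lborel))
     = (\<integral>\<^sup>+w. \<integral>\<^sup>+y. ennreal ((A + (\<Sum>j\<in>insert i I. ((w(i := y)) j - m j)\<^sup>2) / 4) powr (-p)) \<partial>lborel \<partial>Pi\<^sub>M I (\<lambda>_. lborel))"
    using insert by (intro product_nn_integral_insert) auto
  also have "\<dots> = (\<integral>\<^sup>+w. 2 * kappa_integral p * ennreal ((A + (\<Sum>j\<in>I. (w j - m j)\<^sup>2) / 4) powr (-(p - 1/2))) \<partial>Pi\<^sub>M I (\<lambda>_. lborel))"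
  proof (rule nn_integral_cong)
    fix w :: "'i \<Rightarrow> real"
    let ?A = "A + (\<Sum>j\<in>I. (w j - m j)\<^sup>2) / 4"
    have A: "?A > 0" using insert.prems by (intro add_pos_nonneg) (auto intro: sum_nonneg)
    have *: "(\<Sum>j\<in>insert i I. ((w(i := y)) j - m j)\<^sup>2) = (y - m i)\<^sup>2 + (\<Sum>j\<in>I. (w j - m j)\<^sup>2)" for y
    proof -
      have "(\<Sum>j\<in>I. ((w(i := y)) j - m j)\<^sup>2) = (\<Sum>j\<in>I. (w j - m j)\<^sup>2)"
        using insert.hyps by (intro sum.cong) auto
      then show ?thesis using insert.hyps by simp
    qed
    have "(A + (\<Sum>j\<in>insert i I. ((w(i := y)) j - m j)\<^sup>2) / 4) = ?A + (y - m i)\<^sup>2 / 4" for y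
      unfolding * by (simp add: add_divide_distrib)
    then show "(\<integral>\<^sup>+y. ennreal ((A + (\<Sum>j\<in>insert i I. ((w(i := y)) j - m j)\<^sup>2) / 4) powr (-p)) \<partial>lborel)
      = 2 * kappa_integral p * ennreal (?A powr (-(p - 1/2)))"
      using nn_integral_shifted_square[OF A, of "m i" p] by (simp only: minus_diff_eq)
  qed
  also have "\<dots> = 2 * kappa_integral p * (kappa_prod (card I) (p - 1/2) * ennreal (A powr (real (card I) / 2 - (p - 1/2))))"
    by (subst nn_integral_cmult, simp, simp only: insert.IH[OF insert.prems])
  also have "\<dots> = kappa_prod (card (insert i I)) p * ennreal (A powr (real (card (insert i I)) / 2 - p))"
    using insert.hyps by (simp add: mult_ac field_simps)
  finally show ?case .
qed

section \<open>The exact integral of the modulus of the kernel\<close>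

lemma Re_rho2:
  "Re (rho2 z u) = (\<Sum>j\<in>UNIV - {lastidx}. (cmod (z$j - u$j))\<^sup>2) / 4 + (rho z + rho u) / 2"
proof -
  have "Re (rho2 z u) = ((\<Sum>j\<in>UNIV - {lastidx}. Re ((z$j - cnj (u$j))\<^sup>2))
      + 2 * (Im (z$lastidx) + Im (u$lastidx))) / 4"
    by (simp add: rho2_def Re_sum)
  \<comment> \<open>In each coordinate (Re z - Re u)^2 - (Im z + Im u)^2 = |z - u|^2 - 2 (Im z)^2 -
    2 (Im u)^2; the subtracted squares complete the last imaginary parts to \<open>rho z\<close> and
    \<open>rho u\<close>.\<close>
  also have "(\<Sum>j\<in>UNIV - {lastidx}. Re ((z$j - cnj (u$j))\<^sup>2))
      = (\<Sum>j\<in>UNIV - {lastidx}. (cmod (z$j - u$j))\<^sup>2 - 2 * (Im (z$j))\<^sup>2 - 2 * (Im (u$j))\<^sup>2)"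
    by (intro sum.cong refl) (simp only: cmod_power2, simp add: power2_eq_square algebra_simps)
  also have "\<dots> = (\<Sum>j\<in>UNIV - {lastidx}. (cmod (z$j - u$j))\<^sup>2)
      - 2 * (\<Sum>j\<in>UNIV - {lastidx}. (Im (z$j))\<^sup>2) - 2 * (\<Sum>j\<in>UNIV - {lastidx}. (Im (u$j))\<^sup>2)"
    by (simp add: sum_subtractf sum_distrib_left)
  finally show ?thesis
    by (simp add: rho_def field_simps)
qed

text \<open>The point is that this is affine with slope 1/2 in the last real part of u, on which
  \<open>Re (rho2 z u)\<close> depends only through the other coordinates.\<close>

lemma Im_rho2:
  "Im (rho2 z u) = ((\<Sum>j\<in>UNIV - {lastidx}. (Re (z$j) - Re (u$j)) * (Im (z$j) + Im (u$j)))
     - (Re (z$lastidx) - Re (u$lastidx))) / 2"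
proof -
  have "Im (rho2 z u) = ((\<Sum>j\<in>UNIV - {lastidx}. Im ((z$j - cnj (u$j))\<^sup>2))
      - 2 * (Re (z$lastidx) - Re (u$lastidx))) / 4"
    by (simp add: rho2_def Im_sum)
  also have "(\<Sum>j\<in>UNIV - {lastidx}. Im ((z$j - cnj (u$j))\<^sup>2))
      = 2 * (\<Sum>j\<in>UNIV - {lastidx}. (Re (z$j) - Re (u$j)) * (Im (z$j) + Im (u$j)))"
    by (subst sum_distrib_left) (intro sum.cong refl, simp add: power2_eq_square algebra_simps)
  finally show ?thesis by simp
qed

lemma continuous_on_rho [continuous_intros]:
  "continuous_on S f \<Longrightarrow> continuous_on S (\<lambda>x. rho (f x))"
  unfolding rho_def by (intro continuous_intros)

lemma continuous_on_rho2 [continuous_intros]: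
  "continuous_on S f \<Longrightarrow> continuous_on S g \<Longrightarrow> continuous_on S (\<lambda>x. rho2 (f x) (g x))"
  unfolding rho2_def by (intro continuous_intros) auto

lemma borel_measurable_rho [measurable]: "rho \<in> borel_measurable borel"
  by (intro borel_measurable_continuous_onI continuous_intros)

lemma borel_measurable_rho2 [measurable]: "rho2 z \<in> borel_measurable borel"
  by (intro borel_measurable_continuous_onI continuous_intros)

lemma open_TB: "open TB"
  unfolding TB_def by (intro open_Collect_less continuous_intros)

lemma TB_sets [measurable]: "TB \<in> sets borel"
  by (intro borel_open open_TB)

lemma Re_rho2_pos: "z \<in> TB \<Longrightarrow> u \<in> TB \<Longrightarrow> Re (rho2 z u) > 0"
  unfolding Re_rho2 TB_def by (intro add_nonneg_pos) (auto intro!: sum_nonneg)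

section \<open>Splitting off the last complex coordinate\<close>

abbreviation lastRe :: "complex^'n::{finite,linorder}" where "lastRe \<equiv> axis lastidx 1"
abbreviation lastIm :: "complex^'n::{finite,linorder}" where "lastIm \<equiv> axis lastidx \<i>"

text \<open>The 2n - 2 real directions of u'. The two directions of the last coordinate are kept
  apart because they are integrated first.\<close>

definition other_Basis :: "(complex^'n::{finite,linorder}) set" where
  "other_Basis = Basis - {lastRe, lastIm}"

lemma other_Basis_eq:
  "other_Basis = (\<lambda>(j, e). axis j e) ` ((UNIV - {lastidx}) \<times> {1, \<i>})"
  unfolding other_Basis_def Basis_vec_def Basis_complex_def
  by (auto simp: axis_eq_axis)

lemma Basis_eq_insert_other: "Basis = insert lastRe (insert lastIm other_Basis)"
  unfolding other_Basis_def by (auto simp: Basis_complex_def)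

lemma other_Basis_simps [simp]: "finite other_Basis" "lastRe \<noteq> lastIm" "lastRe \<notin> other_Basis" "lastIm \<notin> other_Basis"
  unfolding other_Basis_def by (auto simp: axis_eq_axis)

lemma card_other_Basis: "card (other_Basis :: (complex^'n::{finite,linorder}) set) = 2 * CARD('n) - 2"
proof -
  have "card (Basis :: (complex^('n::{finite,linorder})) set) = card (other_Basis :: (complex^('n::{finite,linorder})) set) + 2"
    unfolding Basis_eq_insert_other by simp
  then show ?thesis by simp
qed

lemma sum_other_Basis:
  fixes f :: "complex^'n::{finite,linorder} \<Rightarrow> real"
  shows "(\<Sum>b\<in>other_Basis. f b) = (\<Sum>j\<in>UNIV - {lastidx}. f (axis j 1) + f (axis j \<i>))"
proof -
  have inj: "inj_on (\<lambda>(j, e). axis j e :: complex^('n::{finite,linorder})) ((UNIV - {lastidx}) \<times> {1, \<i>})"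
    by (auto simp: inj_on_def axis_eq_axis)
  have "(\<Sum>b\<in>other_Basis. f b) = (\<Sum>(j, e)\<in>(UNIV - {lastidx}) \<times> {1, \<i>}. f (axis j e))"
    unfolding other_Basis_eq by (subst sum.reindex[OF inj]) (simp add: case_prod_beta comp_def)
  also have "\<dots> = (\<Sum>j\<in>UNIV - {lastidx}. \<Sum>e\<in>{1, \<i>}. f (axis j e))"
    by (rule sum.cartesian_product[symmetric])
  finally show ?thesis by simp
qed

lemma sum_Basis_nth:
  fixes w :: "complex^'n::{finite,linorder} \<Rightarrow> real"
  shows "Re ((\<Sum>b\<in>Basis. w b *\<^sub>R b) $ j) = w (axis j 1)" (is ?A)
    and "Im ((\<Sum>b\<in>Basis. w b *\<^sub>R b) $ j) = w (axis j \<i>)" (is ?B)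
proof -
  let ?u = "\<Sum>b\<in>Basis. w b *\<^sub>R b"
  have "?u \<bullet> axis j 1 = w (axis j 1)" "?u \<bullet> axis j \<i> = w (axis j \<i>)"
    by (simp_all add: inner_sum_left_Basis Basis_complex_def)
  then show ?A ?B
    by (simp_all only: inner_axis) (simp_all add: inner_complex_def)
qed

text \<open>Lebesgue measure is the image of a product over \<open>Basis\<close>. In this order of
  integration the shear reduces to translations of s and t with the other variables fixed, so no
  change of variables in several dimensions occurs.\<close>

lemma nn_integral_last_coordinate:
  fixes g :: "complex^'n::{finite,linorder} \<Rightarrow> ennreal"
  assumes g [measurable]: "g \<in> borel_measurable borel"
  shows "(\<integral>\<^sup>+u. g u \<partial>lborel) = (\<integral>\<^sup>+w. \<integral>\<^sup>+t. \<integral>\<^sup>+s. g (\<Sum>b\<in>Basis. (w(lastIm := t, lastRe := s)) b *\<^sub>R b)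
      \<partial>lborel \<partial>lborel \<partial>Pi\<^sub>M other_Basis (\<lambda>_. lborel))"
proof -
  interpret product_sigma_finite "\<lambda>_::complex^('n::{finite,linorder}). lborel::real measure" ..
  have m [measurable]: "(\<lambda>w. g (\<Sum>b\<in>Basis. w b *\<^sub>R b)) \<in> borel_measurable (Pi\<^sub>M (insert lastRe (insert lastIm other_Basis)) (\<lambda>_. lborel))"
    unfolding Basis_eq_insert_other[symmetric] by measurable
  have "(\<integral>\<^sup>+u. g u \<partial>lborel) = (\<integral>\<^sup>+w. g (\<Sum>b\<in>Basis. w b *\<^sub>R b) \<partial>Pi\<^sub>M Basis (\<lambda>_. lborel))"
    by (subst lborel_eq, subst nn_integral_distr) auto
  also have "\<dots> = (\<integral>\<^sup>+w. g (\<Sum>b\<in>Basis. w b *\<^sub>R b) \<partial>Pi\<^sub>M (insert lastRe (insert lastIm other_Basis)) (\<lambda>_. lborel))"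
    by (simp only: Basis_eq_insert_other[symmetric])
  also have "\<dots> = (\<integral>\<^sup>+w. \<integral>\<^sup>+s. g (\<Sum>b\<in>Basis. (w(lastRe := s)) b *\<^sub>R b) \<partial>lborel
      \<partial>Pi\<^sub>M (insert lastIm other_Basis) (\<lambda>_. lborel))"
    by (rule product_nn_integral_insert) (use m in auto)
  also have "\<dots> = (\<integral>\<^sup>+w. \<integral>\<^sup>+t. \<integral>\<^sup>+s. g (\<Sum>b\<in>Basis. (w(lastIm := t, lastRe := s)) b *\<^sub>R b)
      \<partial>lborel \<partial>lborel \<partial>Pi\<^sub>M other_Basis (\<lambda>_. lborel))"
    by (rule product_nn_integral_insert)
      (use measurable_compose[OF measurable_add_dim m] in
        \<open>auto intro!: lborel.borel_measurable_nn_integral simp del: fun_upd_apply simp: case_prod_unfold\<close>)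
  finally show ?thesis .
qed

text \<open>The factors come, in this order, from the last real part, the last imaginary part, the
  2n - 2 coordinates of u', and from \<open>rho z\<close> entering as
  \<open>rho z / 2\<close>.\<close>

definition kernel_const :: "nat \<Rightarrow> real \<Rightarrow> real \<Rightarrow> ennreal" where
  "kernel_const n b c = 2 * kappa_integral (c/2) * (ennreal (2 powr (b + 1)) * beta_integral b c)
     * kappa_prod (2 * n - 2) (c - b - 2) * ennreal ((1/2) powr (real n + 1 + b - c))"

lemma kernel_const_pos: "kernel_const n b c > 0"
  unfolding kernel_const_def by (auto simp: ennreal_zero_less_mult_iff kappa_integral_pos beta_integral_pos kappa_prod_pos)

text \<open>All factors are positive, so finiteness is checked factor by factor. The first factor
  yields the c > 1 that \<open>beta_integral_finite_iff\<close> assumes.\<close>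

lemma kernel_const_finite_iff:
  assumes n: "n > 0"
  shows "kernel_const n b c < \<infinity> \<longleftrightarrow> b > -1 \<and> c > real n + 1 + b"
proof
  assume fin: "kernel_const n b c < \<infinity>"
  then have fins: "kappa_integral (c/2) < \<infinity>" "beta_integral b c < \<infinity>" "kappa_prod (2 * n - 2) (c - b - 2) < \<infinity>"
    unfolding kernel_const_def
    using kappa_integral_pos[of "c/2"] beta_integral_pos[of b c] kappa_prod_pos[of "2 * n - 2" "c - b - 2"]
    by (auto simp: ennreal_mult_less_top)
  then have "c > 1" by (simp add: kappa_integral_finite_iff[of "c/2", simplified])
  with fins have b: "b > -1" "c > b + 2" using beta_integral_finite_iff[of c b] by auto
  have "c > real n + 1 + b"
  \<comment> \<open>For n = 1 the product over u' is empty and c > b + 2 is already the claim; for n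
    > 1 the index 2n - 2 is a successor.\<close>
  proof (cases "n = 1")
    case False
    then have eq: "2 * n - 2 = Suc (2 * n - 3)" using n by linarith
    have "real (2 * n - 2) / 2 < c - b - 2"
      using kappa_prod_finiteD[of "2 * n - 3" "c - b - 2"] fins(3) unfolding eq by simp
    then show ?thesis using n by (simp add: of_nat_diff)
  qed (use b in auto)
  with b show "b > -1 \<and> c > real n + 1 + b" by simp
next
  assume *: "b > -1 \<and> c > real n + 1 + b"
  then have "c > 1" "c > b + 2" using n by linarith+
  moreover have "real (2 * n - 2) / 2 < c - b - 2" using * n by (simp add: of_nat_diff)
  ultimately show "kernel_const n b c < \<infinity>"
    unfolding kernel_const_def
    using * kappa_integral_finite_iff[of "c/2"] beta_integral_finite_iff[of c b] kappa_prod_finite[of "2 * n - 2" "c - b - 2"]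
    by (auto simp: ennreal_mult_less_top)
qed

text \<open>In the coordinates \<open>u'\<close>, \<open>\<rho>(u)\<close> and \<open>Im \<rho>(z,u)\<close>, which arise from the real coordinates
  of \<open>u\<close> by a shear, the kernel only depends on \<open>|z' - u'|\<^sup>2\<close>, \<open>\<rho>(z)\<close>, \<open>\<rho>(u)\<close> and
  \<open>Im \<rho>(z,u)\<close>.\<close>

lemma kernel_integral:
  fixes z :: "complex^'n::{finite,linorder}"
  assumes z: "z \<in> TB"
  shows "(\<integral>\<^sup>+u. ennreal (rho u powr b / cmod (rho2 z u) powr c) * indicator TB u \<partial>lborel)
    = kernel_const CARD('n) b c * ennreal (rho z powr (real CARD('n) + 1 + b - c))"
proof -
  let ?p = "c - b - 2"
  define U where "U w s t = (\<Sum>b\<in>Basis. (w(lastIm := t, lastRe := s)) b *\<^sub>R b)"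
    for w :: "complex^('n::{finite,linorder}) \<Rightarrow> real" and s t
  \<comment> \<open>For fixed z these depend on u' alone: \<open>rho u\<close> = t - m,
    \<open>Re (rho2 z u)\<close> = A + (t - m)/2 and \<open>Im (rho2 z u)\<close> = (s +
    h)/2.\<close>
  define m where "m w = (\<Sum>j\<in>UNIV - {lastidx}. (w (axis j \<i>))\<^sup>2)" for w :: "complex^('n::{finite,linorder}) \<Rightarrow> real"
  define A where "A w = rho z / 2 + (\<Sum>b\<in>other_Basis. (w b - z \<bullet> b)\<^sup>2) / 4" for w
  define h where "h w = (\<Sum>j\<in>UNIV - {lastidx}. (Re (z$j) - w (axis j 1)) * (Im (z$j) + w (axis j \<i>))) - Re (z$lastidx)" for w
  have rz: "rho z > 0" using z by (simp add: TB_def)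
  have A_pos: "A w > 0" for w
    unfolding A_def using rz by (intro add_pos_nonneg) (auto intro: sum_nonneg)
  have U_nth: "Re (U w s t $ lastidx) = s" "Im (U w s t $ lastidx) = t"
    "j \<noteq> lastidx \<Longrightarrow> Re (U w s t $ j) = w (axis j 1)" "j \<noteq> lastidx \<Longrightarrow> Im (U w s t $ j) = w (axis j \<i>)" for w s t j
    unfolding U_def sum_Basis_nth by (auto simp: axis_eq_axis)
  have rho_U: "rho (U w s t) = t - m w" for w s t
    unfolding rho_def m_def by (simp add: U_nth)
  have Re_U: "Re (rho2 z (U w s t)) = A w + (t - m w) / 2" for w s t
  proof -
    have "(\<Sum>b\<in>other_Basis. (w b - z \<bullet> b)\<^sup>2) = (\<Sum>j\<in>UNIV - {lastidx}. (cmod (z$j - U w s t $ j))\<^sup>2)"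
      unfolding sum_other_Basis
      by (intro sum.cong refl) (simp only: cmod_power2 inner_axis, simp add: U_nth inner_complex_def power2_commute)
    then show ?thesis
      unfolding Re_rho2 A_def rho_U by (simp add: add_divide_distrib)
  qed
  have Im_U: "Im (rho2 z (U w s t)) = (s + h w) / 2" for w s t
    unfolding Im_rho2 h_def by (simp add: U_nth)
  have inner: "(\<integral>\<^sup>+s. ennreal (rho (U w s t) powr b / cmod (rho2 z (U w s t)) powr c) * indicator TB (U w s t) \<partial>lborel)
      = 2 * kappa_integral (c/2) * (ennreal ((t - m w) powr b * (A w + (t - m w) / 2) powr (1 - c)) * indicator {m w<..} t)"
    for w t
  proof (cases "t > m w")
    case True
    let ?X = "A w + (t - m w) / 2"
    have X: "?X > 0" using A_pos[of w] True by (intro add_pos_pos) auto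
    \<comment> \<open>The squared modulus is a shifted square in s with constant X^2, so p = c/2 and
      the s-integral leaves X^(1-c).\<close>
    have "cmod (rho2 z (U w s t)) powr c = (?X\<^sup>2 + (s - (- h w))\<^sup>2 / 4) powr (c/2)" for s
    proof -
      have "cmod (rho2 z (U w s t)) = sqrt (?X\<^sup>2 + (s - (- h w))\<^sup>2 / 4)"
        unfolding cmod_def Re_U Im_U by (simp add: power_divide)
      also have "\<dots> = (?X\<^sup>2 + (s - (- h w))\<^sup>2 / 4) powr (1/2)"
        by (simp add: powr_half_sqrt)
      finally show ?thesis by (simp add: powr_powr)
    qed
    then have "ennreal (rho (U w s t) powr b / cmod (rho2 z (U w s t)) powr c) * indicator TB (U w s t)
       = ennreal ((t - m w) powr b) * ennreal ((?X\<^sup>2 + (s - (- h w))\<^sup>2 / 4) powr (- (c/2)))" for s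
      using True by (simp add: TB_def rho_U powr_minus_divide ennreal_mult[symmetric])
    then have "(\<integral>\<^sup>+s. ennreal (rho (U w s t) powr b / cmod (rho2 z (U w s t)) powr c) * indicator TB (U w s t) \<partial>lborel)
       = ennreal ((t - m w) powr b) * (2 * kappa_integral (c/2) * ennreal ((?X\<^sup>2) powr (1/2 - c/2)))"
      using X by (simp only:) (subst nn_integral_cmult, simp, subst nn_integral_shifted_square, simp_all)
    also have "(?X\<^sup>2) powr (1/2 - c/2) = ?X powr (1 - c)"
      using X by (simp add: powr_numeral[symmetric] powr_powr right_diff_distrib del: powr_numeral)
    finally show ?thesis
      using True by (simp add: ennreal_mult mult_ac)
  qed (simp add: TB_def rho_U)
  have "(\<integral>\<^sup>+u. ennreal (rho u powr b / cmod (rho2 z u) powr c) * indicator TB u \<partial>lborel)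
    = (\<integral>\<^sup>+w. \<integral>\<^sup>+t. \<integral>\<^sup>+s. ennreal (rho (U w s t) powr b / cmod (rho2 z (U w s t)) powr c) * indicator TB (U w s t)
      \<partial>lborel \<partial>lborel \<partial>Pi\<^sub>M other_Basis (\<lambda>_. lborel))"
    unfolding U_def by (rule nn_integral_last_coordinate) measurable
  also have "\<dots> = (\<integral>\<^sup>+w. 2 * kappa_integral (c/2) * (ennreal (2 powr (b + 1)) * beta_integral b c * ennreal (A w powr (- ?p)))
      \<partial>Pi\<^sub>M other_Basis (\<lambda>_. lborel))"
  proof (rule nn_integral_cong)
    fix w :: "complex^('n::{finite,linorder}) \<Rightarrow> real"
    show "(\<integral>\<^sup>+t. \<integral>\<^sup>+s. ennreal (rho (U w s t) powr b / cmod (rho2 z (U w s t)) powr c) * indicator TB (U w s t)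
        \<partial>lborel \<partial>lborel) = 2 * kappa_integral (c/2) * (ennreal (2 powr (b + 1)) * beta_integral b c * ennreal (A w powr (- ?p)))"
      unfolding inner
      by (subst nn_integral_cmult, simp, subst nn_integral_half_line_beta[OF A_pos]) (simp add: minus_diff_eq diff_diff_eq2 add.commute)
  qed
  also have "\<dots> = (2 * kappa_integral (c/2) * (ennreal (2 powr (b + 1)) * beta_integral b c)) *
      (\<integral>\<^sup>+w. ennreal (A w powr (- ?p)) \<partial>Pi\<^sub>M other_Basis (\<lambda>_. lborel))"
    unfolding A_def by (subst nn_integral_cmult[symmetric]) (auto simp: mult_ac)
  also have "(\<integral>\<^sup>+w. ennreal (A w powr (- ?p)) \<partial>Pi\<^sub>M other_Basis (\<lambda>_. lborel))
      = kappa_prod (2 * CARD('n) - 2) ?p * ennreal ((rho z / 2) powr (real (2 * CARD('n) - 2) / 2 - ?p))"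
    unfolding A_def card_other_Basis[symmetric] using rz by (intro nn_integral_PiM_sum_squares) auto
  also have "real (2 * CARD('n) - 2) / 2 - ?p = real CARD('n) + 1 + b - c"
    by (simp add: of_nat_diff Suc_leI field_simps)
  also have "(rho z / 2) powr (real CARD('n) + 1 + b - c)
      = (1/2) powr (real CARD('n) + 1 + b - c) * rho z powr (real CARD('n) + 1 + b - c)"
    using rz by (simp add: powr_mult[symmetric])
  finally show ?thesis
    unfolding kernel_const_def by (simp add: ennreal_mult mult_ac)
qed

section \<open>Boundedness for kernels with controlled phase\<close>

lemma Mpair_eq_lborel: "Mpair = lborel"
  by (simp add: Mpair_def lborel_prod)

lemma open_Om: "open Om"
  unfolding Om_def by (intro open_Times open_TB)

lemma Om_sets [measurable]: "Om \<in> sets borel"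
  by (intro borel_open open_Om)

lemma AE_Mpair_imp_ex:
  assumes "AE x in Mpair. P x" "open S" "S \<noteq> {}"
  shows "\<exists>x\<in>S. P x"
  using AE_lborel_open_imp_ex[OF assms(1)[unfolded Mpair_eq_lborel] assms(2,3)] .

text \<open>With vanishing u' and last real part, this point shows that the domain is nonempty and
  lets \<open>rho\<close> take every positive value.\<close>

definition point_at_height :: "real \<Rightarrow> complex^'n::{finite,linorder}" where
  "point_at_height r = axis lastidx (\<i> * of_real r)"

lemma rho_point_at_height [simp]: "rho (point_at_height r) = r"
proof -
  have "(\<Sum>j\<in>UNIV - {lastidx::'a}. (Im ((point_at_height r :: complex^'a::{finite,linorder}) $ j))\<^sup>2) = 0"
    by (intro sum.neutral) (auto simp: point_at_height_def axis_def)
  then show ?thesis unfolding rho_def by (simp add: point_at_height_def axis_def)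
qed

lemma point_at_height_in_TB [simp]: "point_at_height r \<in> TB \<longleftrightarrow> r > 0"
  by (simp add: TB_def)

lemma Om_nonempty: "(Om :: ('n::{finite,linorder}) pt set) \<noteq> {}"
proof -
  have "(point_at_height 1, point_at_height 1) \<in> (Om :: ('n::{finite,linorder}) pt set)"
    by (simp add: Om_def)
  then show ?thesis by blast
qed

text \<open>The modulus shared by the kernels of S and T, grouped by variable so that Tonelli splits
  its integral.\<close>

definition abs_kernel :: "real \<Rightarrow> real \<Rightarrow> real \<Rightarrow> real \<Rightarrow> ('n::{finite,linorder}) pt \<Rightarrow> 'n pt \<Rightarrow> real" where
  "abs_kernel b1 b2 c1 c2 x p = rho (fst p) powr b1 / cmod (rho2 (fst x) (fst p)) powr c1 *
     (rho (snd p) powr b2 / cmod (rho2 (snd x) (snd p)) powr c2)"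

lemma abs_kernel_nonneg: "abs_kernel b1 b2 c1 c2 x p \<ge> 0"
  by (simp add: abs_kernel_def)

lemma norm_kerS: "cmod (kerS b1 b2 c1 c2 x p) = abs_kernel b1 b2 c1 c2 x p"
  by (simp add: kerS_def abs_kernel_def case_prod_unfold norm_divide norm_mult)

text \<open>For a real exponent |v^c| = |v|^c, so the principal branch affects only the
  phase.\<close>

lemma norm_kerT: "cmod (kerT b1 b2 c1 c2 x p) = abs_kernel b1 b2 c1 c2 x p"
  by (simp add: kerT_def abs_kernel_def case_prod_unfold norm_divide norm_mult norm_powr_real_powr')

lemma nn_integral_abs_kernel:
  fixes x :: "('n::{finite,linorder}) pt"
  assumes "x \<in> Om"
  shows "(\<integral>\<^sup>+p. ennreal (abs_kernel b1 b2 c1 c2 x p) * indicator Om p \<partial>Mpair)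
     = kernel_const CARD('n) b1 c1 * kernel_const CARD('n) b2 c2 *
       ennreal (rho (fst x) powr (real CARD('n) + 1 + b1 - c1) * rho (snd x) powr (real CARD('n) + 1 + b2 - c2))"
proof -
  have x: "fst x \<in> TB" "snd x \<in> TB" using assms by (auto simp: Om_def)
  define F where "F b c z u = ennreal (rho u powr b / cmod (rho2 z u) powr c) * indicator TB u"
    for b c and z u :: "complex^('n::{finite,linorder})"
  have [measurable]: "F b c z \<in> borel_measurable borel" for b c z
    unfolding F_def by measurable
  have "(\<integral>\<^sup>+p. ennreal (abs_kernel b1 b2 c1 c2 x p) * indicator Om p \<partial>Mpair)
     = (\<integral>\<^sup>+p. F b1 c1 (fst x) (fst p) * F b2 c2 (snd x) (snd p) \<partial>Mpair)"
    by (intro nn_integral_cong)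
      (auto simp: F_def abs_kernel_def Om_def ennreal_mult[symmetric] split: split_indicator)
  also have "\<dots> = (\<integral>\<^sup>+u. \<integral>\<^sup>+v. F b1 c1 (fst x) u * F b2 c2 (snd x) v \<partial>lborel \<partial>lborel)"
    unfolding Mpair_def by (subst lborel.nn_integral_fst[symmetric]) (auto simp: case_prod_unfold)
  also have "\<dots> = (\<integral>\<^sup>+u. F b1 c1 (fst x) u \<partial>lborel) * (\<integral>\<^sup>+v. F b2 c2 (snd x) v \<partial>lborel)"
    by (simp add: nn_integral_cmult nn_integral_multc)
  finally show ?thesis
    unfolding F_def kernel_integral[OF x(1)] kernel_integral[OF x(2)] by (simp add: ennreal_mult mult_ac)
qed

text \<open>Otherwise t = D/th gives exp D \<le> D, against exp D \<ge> 1 + D. The lemma is applied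
  with t the logarithm of a height.\<close>

lemma eq_0_if_exp_bounded:
  fixes th D :: real
  assumes "\<And>t. exp (th * t) \<le> D"
  shows "th = 0"
proof (rule ccontr)
  assume "th \<noteq> 0"
  then have "exp D \<le> D" using assms[of "D / th"] by simp
  then show False using exp_ge_add_one_self[of D] by linarith
qed

text \<open>The last assumption replaces the positivity of the kernel: near every \<open>x\<^sub>0\<close> one test function of
  modulus at most one undoes the oscillation of \<open>K x\<close> up to a factor \<open>2\<close>.\<close>

locale product_kernel =
  fixes b1 b2 c1 c2 :: real and K :: "('n::{finite,linorder}) pt \<Rightarrow> 'n pt \<Rightarrow> complex"
  assumes norm_K: "cmod (K x p) = abs_kernel b1 b2 c1 c2 x p"
    and cont_K: "continuous_on (Om \<times> Om) (\<lambda>y. K (fst y) (snd y))"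
    and phase: "x0 \<in> Om \<Longrightarrow> \<exists>S f. open S \<and> x0 \<in> S \<and> f \<in> borel_measurable borel \<and> (\<forall>p. cmod (f p) \<le> 1) \<and>
      (\<forall>x\<in>S \<inter> Om. \<forall>p\<in>Om. cmod (K x p) \<le> 2 * Re (K x p * f p))"
begin

lemma joint_measurable:
  "(\<lambda>y. indicator Om (fst y) *\<^sub>R indicator Om (snd y) *\<^sub>R K (fst y) (snd y)) \<in> borel_measurable borel"
proof -
  have "(\<lambda>y. indicator (Om \<times> Om) y *\<^sub>R K (fst y) (snd y)) \<in> borel_measurable borel"
    by (intro borel_measurable_continuous_on_indicator cont_K borel_open open_Times open_Om)
  then show ?thesis by (simp add: indicator_times mult_ac)
qed

lemma section_measurable:
  assumes "x \<in> Om"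
  shows "(\<lambda>p. indicator Om p *\<^sub>R K x p) \<in> borel_measurable borel"
proof -
  have "(\<lambda>p. (x, p)) \<in> borel \<rightarrow>\<^sub>M borel"
    by (intro borel_measurable_continuous_onI continuous_intros)
  from measurable_compose[OF this joint_measurable] show ?thesis
    using assms by simp
qed

lemma set_integrable_iff:
  assumes "x \<in> Om"
  shows "set_integrable Mpair Om (K x) \<longleftrightarrow>
    (\<integral>\<^sup>+p. ennreal (abs_kernel b1 b2 c1 c2 x p) * indicator Om p \<partial>Mpair) < \<infinity>"
proof -
  have "(\<integral>\<^sup>+p. ennreal (norm (indicator Om p *\<^sub>R K x p)) \<partial>Mpair)
     = (\<integral>\<^sup>+p. ennreal (abs_kernel b1 b2 c1 c2 x p) * indicator Om p \<partial>Mpair)"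
    by (intro nn_integral_cong) (auto simp: norm_K split: split_indicator)
  then show ?thesis
    using section_measurable[OF assms]
    unfolding set_integrable_def integrable_iff_bounded by (simp add: Mpair_eq_lborel)
qed

text \<open>A parametrized Bochner integral is measurable without integrability, taking the value 0
  where the integral diverges.\<close>

lemma kernel_op_measurable:
  assumes f: "f \<in> borel_measurable Mpair"
  shows "(\<lambda>x. indicator Om x *\<^sub>R kernel_op (pref a1 a2) K f x) \<in> borel_measurable Mpair"
proof -
  have [measurable]: "f \<in> borel_measurable borel" using f by (simp add: Mpair_eq_lborel)
  have [measurable]: "fst \<in> borel \<rightarrow>\<^sub>M (borel :: ('n::{finite,linorder}) pt measure)"
    "snd \<in> borel \<rightarrow>\<^sub>M (borel :: ('n::{finite,linorder}) pt measure)"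
    by (intro borel_measurable_continuous_onI continuous_intros)+
  have [measurable]: "fst \<in> borel \<rightarrow>\<^sub>M (borel :: (complex^('n::{finite,linorder})) measure)"
    "snd \<in> borel \<rightarrow>\<^sub>M (borel :: (complex^('n::{finite,linorder})) measure)"
    by (intro borel_measurable_continuous_onI continuous_intros)+
  have pref [measurable]: "pref a1 a2 \<in> borel_measurable (borel :: ('n::{finite,linorder}) pt measure)"
    unfolding pref_def case_prod_unfold by measurable
  have sets_pair: "sets (borel \<Otimes>\<^sub>M lborel) = sets (borel :: ('n pt \<times> 'n pt) measure)"
    by (simp add: borel_prod[symmetric] cong: sets_pair_measure_cong)
  have "(\<lambda>y. (indicator Om (fst y) *\<^sub>R indicator Om (snd y) *\<^sub>R K (fst y) (snd y)) * f (snd y)) \<in> borel_measurable borel"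
    by (intro borel_measurable_times joint_measurable) measurable
  then have "(\<lambda>(x, p). (indicator Om x *\<^sub>R indicator Om p *\<^sub>R K x p) * f p) \<in> borel_measurable (borel \<Otimes>\<^sub>M lborel)"
    unfolding measurable_cong_sets[OF sets_pair refl] case_prod_unfold .
  then have "(\<lambda>x. \<integral>p. (indicator Om x *\<^sub>R indicator Om p *\<^sub>R K x p) * f p \<partial>lborel) \<in> borel_measurable borel"
    by (rule lborel.borel_measurable_lebesgue_integral)
  then have "(\<lambda>x. complex_of_real (pref a1 a2 x) *
      (\<integral>p. (indicator Om x *\<^sub>R indicator Om p *\<^sub>R K x p) * f p \<partial>lborel)) \<in> borel_measurable borel"
    by measurable
  also have "(\<lambda>x. complex_of_real (pref a1 a2 x) *
      (\<integral>p. (indicator Om x *\<^sub>R indicator Om p *\<^sub>R K x p) * f p \<partial>lborel))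
     = (\<lambda>x. indicator Om x *\<^sub>R kernel_op (pref a1 a2) K f x)"
    by (auto simp: kernel_op_def set_lebesgue_integral_def Mpair_eq_lborel fun_eq_iff split: split_indicator)
  finally show ?thesis by (simp add: Mpair_eq_lborel)
qed

text \<open>The relation between the exponents makes the integral of the modulus a constant times
  rho(z)^(-a1) rho(w)^(-a2), which the prefactor cancels; a_i > 0 then amounts to the convergence
  condition c_i > n + 1 + b_i.\<close>

lemma bounded_if:
  assumes c: "c1 = real CARD('n) + 1 + a1 + b1" "c2 = real CARD('n) + 1 + a2 + b2"
    and pos: "a1 > 0" "b1 > -1" "a2 > 0" "b2 > -1"
  shows "bounded_Linf (pref a1 a2) K"
proof -
  let ?k = "kernel_const CARD('n) b1 c1 * kernel_const CARD('n) b2 c2"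
  have "?k < \<infinity>"
    using kernel_const_finite_iff[of "CARD('n)" b1 c1] kernel_const_finite_iff[of "CARD('n)" b2 c2] c pos
    by (auto simp: ennreal_mult_less_top)
  then obtain C where C: "?k = ennreal C" "C \<ge> 0"
    by (cases ?k) auto
  have I: "(\<integral>\<^sup>+p. ennreal (abs_kernel b1 b2 c1 c2 x p) * indicator Om p \<partial>Mpair)
      = ennreal (C * (rho (fst x) powr (- a1) * rho (snd x) powr (- a2)))" if "x \<in> Om" for x :: "'n pt"
    unfolding nn_integral_abs_kernel[OF that] C(1) using c C(2) by (simp add: ennreal_mult)
  show ?thesis
    unfolding bounded_Linf_def
  proof (intro exI[of _ C] allI impI conjI)
    fix f :: "'n pt \<Rightarrow> complex" and M0 :: real
    assume f: "f \<in> borel_measurable Mpair" and bd: "AE p in Mpair. p \<in> Om \<longrightarrow> cmod (f p) \<le> M0"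
    have [measurable]: "f \<in> borel_measurable borel" using f by (simp add: Mpair_eq_lborel)
    \<comment> \<open>\<open>M0\<close> is an arbitrary real; a point of \<open>Om\<close> where the
      bound holds shows that it is nonnegative.\<close>
    have "M0 \<ge> 0"
      using AE_Mpair_imp_ex[OF bd open_Om Om_nonempty] by (meson norm_ge_zero order_trans)
    show "(\<lambda>x. indicator Om x *\<^sub>R kernel_op (pref a1 a2) K f x) \<in> borel_measurable Mpair"
      by (rule kernel_op_measurable[OF f])
    have le: "(\<integral>\<^sup>+p. ennreal (norm (indicator Om p *\<^sub>R (K x p * f p))) \<partial>Mpair)
        \<le> ennreal (C * (rho (fst x) powr (- a1) * rho (snd x) powr (- a2)) * M0)" if x: "x \<in> Om" for x
    proof -
      have "(\<lambda>p. norm (indicator Om p *\<^sub>R K x p)) \<in> borel_measurable borel"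
        using section_measurable[OF x] by measurable
      then have m: "(\<lambda>p. ennreal (norm (indicator Om p *\<^sub>R K x p))) \<in> borel_measurable Mpair"
        by (simp add: Mpair_eq_lborel)
      have "(\<integral>\<^sup>+p. ennreal (norm (indicator Om p *\<^sub>R (K x p * f p))) \<partial>Mpair)
        \<le> (\<integral>\<^sup>+p. ennreal (norm (indicator Om p *\<^sub>R K x p)) * ennreal M0 \<partial>Mpair)"
        using bd
        by (intro nn_integral_mono_AE, eventually_elim)
          (auto split: split_indicator simp: norm_mult ennreal_mult intro!: mult_left_mono ennreal_leI)
      also have "\<dots> = (\<integral>\<^sup>+p. ennreal (norm (indicator Om p *\<^sub>R K x p)) \<partial>Mpair) * ennreal M0"
        by (rule nn_integral_multc[OF m])
      also have "(\<integral>\<^sup>+p. ennreal (norm (indicator Om p *\<^sub>R K x p)) \<partial>Mpair)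
          = (\<integral>\<^sup>+p. ennreal (abs_kernel b1 b2 c1 c2 x p) * indicator Om p \<partial>Mpair)"
        by (intro nn_integral_cong) (auto simp: norm_K split: split_indicator)
      finally show ?thesis
        unfolding I[OF x] using C(2) \<open>M0 \<ge> 0\<close> by (simp add: ennreal_mult)
    qed
    have int: "set_integrable Mpair Om (\<lambda>p. K x p * f p)" if x: "x \<in> Om" for x
    proof -
      have "(\<lambda>p. (indicator Om p *\<^sub>R K x p) * f p) \<in> borel_measurable borel"
        using section_measurable[OF x] by measurable
      then show ?thesis
        unfolding set_integrable_def using le_less_trans[OF le[OF x] ennreal_less_top]
        by (intro integrableI_bounded) (auto simp: Mpair_eq_lborel)
    qed
    then show "AE x in Mpair. x \<in> Om \<longrightarrow> set_integrable Mpair Om (\<lambda>p. K x p * f p)"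
      by simp
    have "cmod (kernel_op (pref a1 a2) K f x) \<le> C * M0" if x: "x \<in> Om" for x
    proof -
      have r: "rho (fst x) > 0" "rho (snd x) > 0" using x by (auto simp: Om_def TB_def)
      have "ennreal (norm (set_lebesgue_integral Mpair Om (\<lambda>p. K x p * f p)))
          \<le> ennreal (C * (rho (fst x) powr (- a1) * rho (snd x) powr (- a2)) * M0)"
        unfolding set_lebesgue_integral_def
        using integral_norm_bound_ennreal[OF int[OF x, unfolded set_integrable_def]] le[OF x]
        by (rule order_trans)
      then have "norm (set_lebesgue_integral Mpair Om (\<lambda>p. K x p * f p))
          \<le> C * (rho (fst x) powr (- a1) * rho (snd x) powr (- a2)) * M0"
        using C(2) \<open>M0 \<ge> 0\<close> by simp
      then have "cmod (kernel_op (pref a1 a2) K f x) \<le>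
          (rho (fst x) powr a1 * rho (snd x) powr a2) *
          (C * (rho (fst x) powr (- a1) * rho (snd x) powr (- a2)) * M0)"
        unfolding kernel_op_def by (auto simp: norm_mult pref_def case_prod_unfold intro!: mult_left_mono)
      also have "\<dots> = C * M0 * (rho (fst x) powr a1 * rho (fst x) powr (- a1))
          * (rho (snd x) powr a2 * rho (snd x) powr (- a2))"
        by (simp only: mult_ac)
      also have "\<dots> = C * M0" using r by (simp add: powr_add[symmetric])
      finally show ?thesis .
    qed
    then show "AE x in Mpair. x \<in> Om \<longrightarrow> cmod (kernel_op (pref a1 a2) K f x) \<le> C * M0"
      by simp
  qed
qed

lemma bounded_onlyif:
  assumes "bounded_Linf (pref a1 a2) K"
  shows "a1 > 0 \<and> b1 > -1 \<and> c1 = real CARD('n) + 1 + a1 + b1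
       \<and> a2 > 0 \<and> b2 > -1 \<and> c2 = real CARD('n) + 1 + a2 + b2"
proof -
  let ?k = "kernel_const CARD('n) b1 c1 * kernel_const CARD('n) b2 c2"
  obtain C where C: "\<And>f M0. f \<in> borel_measurable Mpair \<Longrightarrow> (AE p in Mpair. p \<in> Om \<longrightarrow> cmod (f p) \<le> M0) \<Longrightarrow>
       (AE x in Mpair. x \<in> Om \<longrightarrow> set_integrable Mpair Om (\<lambda>p. K x p * f p))
     \<and> (AE x in Mpair. x \<in> Om \<longrightarrow> cmod (kernel_op (pref a1 a2) K f x) \<le> C * M0)"
    using assms unfolding bounded_Linf_def by blast
  \<comment> \<open>Testing with f = 1 makes the integral of the modulus finite at some point. As
    both constants are positive, both are finite, which gives the convergence conditions.\<close>
  have "AE x in Mpair. x \<in> Om \<longrightarrow> set_integrable Mpair Om (K x)"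
    using C[of "\<lambda>_. 1" 1] by simp
  from AE_Mpair_imp_ex[OF this open_Om Om_nonempty]
  obtain x where x: "x \<in> Om" "set_integrable Mpair Om (K x)" by blast
  have "rho (fst x) > 0" "rho (snd x) > 0" using x by (auto simp: Om_def TB_def)
  then have fin: "kernel_const CARD('n) b1 c1 < \<infinity>" "kernel_const CARD('n) b2 c2 < \<infinity>"
    using x kernel_const_pos[of "CARD('n)" b1 c1] kernel_const_pos[of "CARD('n)" b2 c2]
    by (auto simp: set_integrable_iff nn_integral_abs_kernel ennreal_mult_less_top)
  then have bc: "b1 > -1" "c1 > real CARD('n) + 1 + b1" "b2 > -1" "c2 > real CARD('n) + 1 + b2"
    using kernel_const_finite_iff[of "CARD('n)" b1 c1] kernel_const_finite_iff[of "CARD('n)" b2 c2] by auto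
  have "?k < \<infinity>" "?k > 0"
    using fin kernel_const_pos by (auto simp: ennreal_mult_less_top ennreal_zero_less_mult_iff)
  then obtain k where k: "?k = ennreal k" "k > 0"
    by (cases ?k) auto
  define q1 where "q1 = real CARD('n) + 1 + b1 - c1"
  define q2 where "q2 = real CARD('n) + 1 + b2 - c2"
  \<comment> \<open>On \<open>Om\<close>, \<open>k * g x\<close> is the prefactor at x times the
    integral of the modulus of \<open>K x\<close>.\<close>
  define g :: "'n pt \<Rightarrow> real" where "g x = rho (fst x) powr (a1 + q1) * rho (snd x) powr (a2 + q2)" for x
  have I: "(\<integral>\<^sup>+p. ennreal (abs_kernel b1 b2 c1 c2 x p) * indicator Om p \<partial>Mpair)
      = ennreal (k * (rho (fst x) powr q1 * rho (snd x) powr q2))" if "x \<in> Om" for x :: "'n pt"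
    unfolding nn_integral_abs_kernel[OF that] k(1) q1_def q2_def using k(2) by (simp add: ennreal_mult)
  have cont_g: "continuous_on Om g"
    unfolding g_def by (intro continuous_intros) (auto simp: Om_def TB_def)
  \<comment> \<open>One factor 2 is lost to the phase assumption, the other because the operator
    bound holds only almost everywhere: x0 is replaced by a nearby x with g x > g x0 / 2.\<close>
  have bound: "k * g x0 \<le> 4 * C" if x0: "x0 \<in> Om" for x0
  proof -
    obtain S f where S: "open S" "x0 \<in> S" and f: "f \<in> borel_measurable borel" "\<And>p. cmod (f p) \<le> 1"
      and ph: "\<And>x p. x \<in> S \<Longrightarrow> x \<in> Om \<Longrightarrow> p \<in> Om \<Longrightarrow> cmod (K x p) \<le> 2 * Re (K x p * f p)"
      using phase[OF x0] by blast
    have g0: "g x0 > 0" using x0 by (auto simp: g_def Om_def TB_def)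
    let ?S = "S \<inter> (Om \<inter> g -` {g x0 / 2<..})"
    have "open ?S"
      by (intro open_Int S continuous_open_preimage cont_g open_Om) auto
    moreover have "x0 \<in> ?S" using S x0 g0 by auto
    moreover have "AE x in Mpair. x \<in> Om \<longrightarrow> set_integrable Mpair Om (\<lambda>p. K x p * f p)
        \<and> cmod (kernel_op (pref a1 a2) K f x) \<le> C"
      using C[of f 1] f by (auto simp: Mpair_eq_lborel)
    ultimately obtain x where x: "x \<in> S" "x \<in> Om" "g x > g x0 / 2"
      and int: "set_integrable Mpair Om (\<lambda>p. K x p * f p)"
      and Cx: "cmod (kernel_op (pref a1 a2) K f x) \<le> C"
      using AE_Mpair_imp_ex[of _ ?S] by blast
    let ?J = "rho (fst x) powr q1 * rho (snd x) powr q2"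
    have int': "integrable Mpair (\<lambda>p. indicator Om p *\<^sub>R (K x p * f p))"
      using int by (simp add: set_integrable_def)
    have "ennreal (k * ?J) \<le> (\<integral>\<^sup>+p. ennreal (2 * Re (indicator Om p *\<^sub>R (K x p * f p))) \<partial>Mpair)"
      unfolding I[OF x(2), symmetric] using ph[OF x(1,2)]
      by (intro nn_integral_mono) (auto simp: norm_K[symmetric] intro!: ennreal_leI split: split_indicator)
    also have "\<dots> = ennreal (\<integral>p. 2 * Re (indicator Om p *\<^sub>R (K x p * f p)) \<partial>Mpair)"
    proof (rule nn_integral_eq_integral)
      show "integrable Mpair (\<lambda>p. 2 * Re (indicator Om p *\<^sub>R (K x p * f p)))"
        using int' by (intro integrable_mult_right integrable_Re)
      show "AE p in Mpair. 0 \<le> 2 * Re (indicator Om p *\<^sub>R (K x p * f p))"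
        using order_trans[OF norm_ge_zero ph[OF x(1,2)]]
        by (intro AE_I2) (simp add: indicator_def del: times_complex.sel)
    qed
    also have "(\<integral>p. 2 * Re (indicator Om p *\<^sub>R (K x p * f p)) \<partial>Mpair)
       = 2 * Re (set_lebesgue_integral Mpair Om (\<lambda>p. K x p * f p))"
      unfolding set_lebesgue_integral_def by (simp add: integral_Re[OF int'] del: scaleR_complex.sel)
    finally have le: "ennreal (k * ?J) \<le> ennreal (2 * Re (set_lebesgue_integral Mpair Om (\<lambda>p. K x p * f p)))" .
    have r: "rho (fst x) > 0" "rho (snd x) > 0" using x by (auto simp: Om_def TB_def)
    \<comment> \<open>\<open>ennreal\<close> sends negative reals to 0, so the left side must be
      positive to return to a real inequality.\<close>
    then have "k * ?J > 0" using k(2) by simp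
    with le have "k * ?J \<le> 2 * Re (set_lebesgue_integral Mpair Om (\<lambda>p. K x p * f p))"
      by (auto simp: ennreal_le_iff2)
    also have "\<dots> \<le> 2 * cmod (set_lebesgue_integral Mpair Om (\<lambda>p. K x p * f p))"
      by (simp add: complex_Re_le_cmod)
    finally have "pref a1 a2 x * (k * ?J) \<le> pref a1 a2 x * (2 * cmod (set_lebesgue_integral Mpair Om (\<lambda>p. K x p * f p)))"
      by (intro mult_left_mono) (auto simp: pref_def case_prod_unfold)
    also have "\<dots> = 2 * cmod (kernel_op (pref a1 a2) K f x)"
      by (simp add: kernel_op_def norm_mult pref_def case_prod_unfold)
    also have "\<dots> \<le> 2 * C" using Cx by simp
    also have "pref a1 a2 x * (k * ?J) = k * g x"
      by (simp add: g_def pref_def case_prod_unfold powr_add mult_ac)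
    finally have "k * g x \<le> 2 * C" .
    moreover have "k * (g x0 / 2) \<le> k * g x" using x(3) k(2) by (intro mult_left_mono) auto
    ultimately show ?thesis by simp
  qed
  \<comment> \<open>One height is fixed at 1 and the other is exp t, which isolates a single
    exponent. Letting t run over all reals tests heights near 0 and near infinity.\<close>
  have "exp ((a1 + q1) * t) \<le> 4 * C / k" for t
    using bound[of "(point_at_height (exp t), point_at_height 1)"] k(2)
    by (simp add: g_def Om_def powr_def field_simps)
  then have "a1 + q1 = 0" by (rule eq_0_if_exp_bounded)
  moreover have "exp ((a2 + q2) * t) \<le> 4 * C / k" for t
    using bound[of "(point_at_height 1, point_at_height (exp t))"] k(2)
    by (simp add: g_def Om_def powr_def field_simps)
  then have "a2 + q2 = 0" by (rule eq_0_if_exp_bounded)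
  \<comment> \<open>Now a_i = -q_i = c_i - n - 1 - b_i, which is positive by the convergence
    condition.\<close>
  ultimately show ?thesis using bc by (auto simp: q1_def q2_def)
qed

end

section \<open>The phase of the kernel of T\<close>

lemma powr_divide_right_half_plane:
  fixes v w :: complex
  assumes "Re v > 0" "Re w > 0"
  shows "(v / w) powr s = v powr s / w powr s"
proof -
  have nz: "v \<noteq> 0" "w \<noteq> 0" using assms by auto
  \<comment> \<open>Both arguments lie strictly between -pi/2 and pi/2, so their difference stays in
    the range of the principal logarithm.\<close>
  have "Ln (v / w) = Ln v - Ln w"
  proof (rule Ln_unique)
    show "exp (Ln v - Ln w) = v / w" using nz by (simp add: exp_diff)
  qed (use Re_Ln_pos_lt_imp[OF assms(1)] Re_Ln_pos_lt_imp[OF assms(2)] in auto)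
  then show ?thesis
    using nz by (simp add: powr_def exp_diff right_diff_distrib)
qed

text \<open>At (1, 1) the function 2 Re F - |F| equals 1, and continuity keeps it positive
  nearby.\<close>

lemma Re_powr_product_near_1:
  fixes s1 s2 :: complex
  obtains e where "e > 0" and "\<And>q1 q2. cmod (q1 - 1) < e \<Longrightarrow> cmod (q2 - 1) < e \<Longrightarrow>
    cmod (1 / (q1 powr s1 * q2 powr s2)) \<le> 2 * Re (1 / (q1 powr s1 * q2 powr s2))"
proof -
  define F where "F = (\<lambda>q::complex \<times> complex. 1 / (fst q powr s1 * snd q powr s2))"
  have F: "isCont F (1, 1)"
    unfolding F_def by (intro continuous_intros isCont_powr_complex) auto
  have "isCont (\<lambda>q. 2 * Re (F q) - cmod (F q)) (1, 1)"
    by (intro continuous_intros isCont_Re F)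
  moreover have "2 * Re (F (1, 1)) - cmod (F (1, 1)) > 0" by (simp add: F_def)
  ultimately have "eventually (\<lambda>q. 2 * Re (F q) - cmod (F q) > 0) (nhds (1, 1))"
    unfolding isCont_def by (intro order_tendstoD(1)[OF iffD1[OF tendsto_at_iff_tendsto_nhds]])
  then obtain d where d: "d > 0" "\<And>q. dist q (1, 1) < d \<Longrightarrow> 2 * Re (F q) - cmod (F q) > 0"
    unfolding eventually_nhds_metric by blast
  show thesis
  proof (rule that[of "d/2"])
    fix q1 q2 :: complex assume q: "cmod (q1 - 1) < d/2" "cmod (q2 - 1) < d/2"
    have "dist (q1, q2) (1, 1) \<le> dist q1 1 + dist q2 1"
      by (simp add: dist_Pair_Pair sqrt_sum_squares_le_sum)
    also have "\<dots> < d" using q by (simp add: dist_norm)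
    finally show "cmod (1 / (q1 powr s1 * q2 powr s2)) \<le> 2 * Re (1 / (q1 powr s1 * q2 powr s2))"
      using d(2)[of "(q1, q2)"] by (simp add: F_def)
  qed (use d in auto)
qed

text \<open>The quotient is close to \<open>1\<close> uniformly in \<open>u\<close> because the numerator of its difference to
  \<open>1\<close> grows linearly in \<open>u' - z\<^sub>0'\<close>, whereas \<open>Re \<rho>(z\<^sub>0,u)\<close> grows quadratically.\<close>

lemma rho2_quotient_near_1:
  fixes z0 :: "complex^'n::{finite,linorder}"
  assumes z0: "z0 \<in> TB" and "e > 0"
  obtains d where "d > 0" and "\<And>z u. dist z z0 < d \<Longrightarrow> u \<in> TB \<Longrightarrow> cmod (rho2 z u / rho2 z0 u - 1) < e"
proof -
  let ?N = "real CARD('n)"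
  \<comment> \<open>\<open>M\<close> absorbs the linear bound 1 + 6 r + 4 |z0| into M (1 + r^2), by
    r \<le> 1 + r^2.\<close>
  define M where "M = 7 + 4 * norm z0"
  \<comment> \<open>\<open>L\<close> is chosen so that (n + R)/4 \<le> L (R/4 + rho(z0)/2), where R
    is the sum of the |z0_j - u_j|^2 and the bracket is a lower bound of
    \<open>Re (rho2 z0 u)\<close>.\<close>
  define L where "L = 1 + ?N / (2 * rho z0)"
  have r0: "rho z0 > 0" using z0 by (simp add: TB_def)
  have bounds: "M \<ge> 7" "L \<ge> 1" "M * L > 0" using r0 by (auto simp: M_def L_def add_pos_nonneg)
  show thesis
  proof (rule that[of "min 1 (e / (M * L))"])
    show "min 1 (e / (M * L)) > 0" using \<open>e > 0\<close> bounds by simp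
    fix z u :: "complex^('n::{finite,linorder})"
    assume z: "dist z z0 < min 1 (e / (M * L))" and u: "u \<in> TB"
    define dl where "dl = norm (z - z0)"
    have dl: "dl \<ge> 0" "dl \<le> 1" "dl < e / (M * L)" using z by (auto simp: dl_def dist_norm)
    have dj: "cmod (z$j - z0$j) \<le> dl" for j
      using Finite_Cartesian_Product.norm_nth_le[of "z - z0" j] by (simp add: dl_def)
    let ?R = "\<Sum>j\<in>UNIV - {lastidx}. (cmod (z0$j - u$j))\<^sup>2"
    have diff_le: "cmod ((z$j - cnj (u$j))\<^sup>2 - (z0$j - cnj (u$j))\<^sup>2) \<le> dl * (M * (1 + (cmod (z0$j - u$j))\<^sup>2))" for j
    proof -
      let ?r = "cmod (z0$j - u$j)"
      \<comment> \<open>Expressing z_j + z0_j - 2 cnj(u_j) through u_j - z0_j and u_j - cnj(u_j)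
        leaves only Im u_j to control, which is at most |z0| + |z0_j - u_j|.\<close>
      have *: "(z$j - cnj (u$j))\<^sup>2 - (z0$j - cnj (u$j))\<^sup>2
          = (z$j - z0$j) * ((z$j - z0$j) - 2 * (u$j - z0$j) + 2 * (u$j - cnj (u$j)))"
        by (simp add: power2_eq_square algebra_simps)
      have tri: "cmod (a - 2 * b + 2 * c) \<le> cmod a + 2 * cmod b + 2 * cmod c" for a b c :: complex
        using norm_triangle_ineq[of "a - 2 * b" "2 * c"] norm_triangle_ineq4[of a "2 * b"]
        by (simp add: norm_mult)
      have "cmod (u$j - cnj (u$j)) = 2 * \<bar>Im (u$j)\<bar>"
        by (simp add: complex_diff_cnj norm_mult)
      also have "\<bar>Im (u$j)\<bar> \<le> \<bar>Im (z0$j)\<bar> + \<bar>Im (z0$j - u$j)\<bar>" by simp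
      also have "\<dots> \<le> norm z0 + ?r"
        using abs_Im_le_cmod[of "z0$j"] abs_Im_le_cmod[of "z0$j - u$j"] Finite_Cartesian_Product.norm_nth_le[of z0 j] by linarith
      finally have 1: "cmod (u$j - cnj (u$j)) \<le> 2 * norm z0 + 2 * ?r" by simp
      have "cmod ((z$j - z0$j) - 2 * (u$j - z0$j) + 2 * (u$j - cnj (u$j)))
          \<le> cmod (z$j - z0$j) + 2 * ?r + 2 * cmod (u$j - cnj (u$j))"
        using tri[of "z$j - z0$j" "u$j - z0$j"] by (simp only: norm_minus_commute[of "z0$j"])
      also have "\<dots> \<le> 1 + 6 * ?r + 4 * norm z0" using 1 dj[of j] dl by simp
      also have "\<dots> \<le> M * (1 + ?r\<^sup>2)"
      proof -
        define t where "t = 1 + ?r\<^sup>2"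
        have "?r \<le> t" using zero_le_power2[of "?r - 1"] zero_le_power2[of ?r]
          unfolding t_def power2_diff by (simp only: one_power2 mult_1_right)
        moreover have "1 \<le> t" unfolding t_def by simp
        moreover from this have "4 * norm z0 \<le> 4 * norm z0 * t"
          using mult_left_mono[of 1 t "4 * norm z0"] by simp
        moreover have "M * t = 7 * t + 4 * norm z0 * t"
          unfolding M_def by (rule distrib_right)
        ultimately show ?thesis unfolding t_def[symmetric] by linarith
      qed
      finally show ?thesis
        unfolding * norm_mult using dj[of j] dl by (intro mult_mono) auto
    qed
    have "rho2 z u - rho2 z0 u = (1/4) * ((\<Sum>j\<in>UNIV - {lastidx}. (z$j - cnj (u$j))\<^sup>2 - (z0$j - cnj (u$j))\<^sup>2)
        - 2 * \<i> * (z$lastidx - z0$lastidx))"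
      unfolding rho2_def by (simp add: sum_subtractf algebra_simps)
    then have "cmod (rho2 z u - rho2 z0 u) = (1/4) * cmod ((\<Sum>j\<in>UNIV - {lastidx}. (z$j - cnj (u$j))\<^sup>2 - (z0$j - cnj (u$j))\<^sup>2)
        - 2 * \<i> * (z$lastidx - z0$lastidx))"
      by (simp only: norm_mult norm_divide) simp
    also have "\<dots> \<le> (1/4) * (cmod (\<Sum>j\<in>UNIV - {lastidx}. (z$j - cnj (u$j))\<^sup>2 - (z0$j - cnj (u$j))\<^sup>2)
        + cmod (2 * \<i> * (z$lastidx - z0$lastidx)))"
      by (intro mult_left_mono norm_triangle_ineq4) auto
    also have "\<dots> \<le> (1/4) * ((\<Sum>j\<in>UNIV - {lastidx}. dl * (M * (1 + (cmod (z0$j - u$j))\<^sup>2))) + 2 * dl)"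
      using dj[of lastidx] by (intro mult_left_mono add_mono sum_norm_le diff_le) (auto simp: norm_mult)
    also have "(\<Sum>j\<in>UNIV - {lastidx}. dl * (M * (1 + (cmod (z0$j - u$j))\<^sup>2))) = dl * M * ((?N - 1) + ?R)"
      by (simp add: sum_distrib_left[symmetric] sum.distrib card_Diff_singleton of_nat_diff Suc_leI mult_ac)
    \<comment> \<open>The contribution 2 dl of the last coordinate is absorbed as the missing n-th
      summand, since M \<ge> 2.\<close>
    also have "(1/4) * (dl * M * ((?N - 1) + ?R) + 2 * dl) \<le> (1/4) * (dl * M * (?N + ?R))"
    proof -
      have "2 * dl \<le> M * dl" using bounds dl by (intro mult_right_mono) auto
      then show ?thesis by (simp add: algebra_simps)
    qed
    also have "\<dots> = dl * M * ((?N + ?R) / 4)" by simp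
    also have "\<dots> \<le> dl * M * (L * Re (rho2 z0 u))"
    proof (intro mult_left_mono)
      have R: "?R \<ge> 0" by (intro sum_nonneg) auto
      have "rho u > 0" using u by (simp add: TB_def)
      then have "?R / 4 + rho z0 / 2 \<le> Re (rho2 z0 u)" unfolding Re_rho2 by simp
      then have "L * (?R / 4 + rho z0 / 2) \<le> L * Re (rho2 z0 u)"
        using bounds by (intro mult_left_mono) auto
      moreover have "1 * (?R / 4) \<le> L * (?R / 4)" using bounds R by (intro mult_right_mono) auto
      moreover have "L * (rho z0 / 2) = rho z0 / 2 + ?N / 4"
        using r0 unfolding L_def by (simp add: field_simps)
      ultimately show "(?N + ?R) / 4 \<le> L * Re (rho2 z0 u)"
        using r0 unfolding distrib_left add_divide_distrib by linarith
    qed (use dl bounds in auto)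
    also have "\<dots> \<le> dl * M * (L * cmod (rho2 z0 u))"
      using dl bounds by (intro mult_left_mono complex_Re_le_cmod) auto
    finally have le: "cmod (rho2 z u - rho2 z0 u) \<le> dl * M * L * cmod (rho2 z0 u)" by (simp add: mult.assoc)
    have nz: "rho2 z0 u \<noteq> 0" using Re_rho2_pos[OF z0 u] by auto
    have "cmod (rho2 z u / rho2 z0 u - 1) = cmod (rho2 z u - rho2 z0 u) / cmod (rho2 z0 u)"
      using nz by (simp add: norm_divide[symmetric] diff_divide_distrib)
    also have "\<dots> \<le> dl * M * L" using le nz by (simp add: divide_le_eq)
    also have "\<dots> < e" using dl(3) bounds by (simp add: less_divide_eq mult.assoc)
    finally show "cmod (rho2 z u / rho2 z0 u - 1) < e" .
  qed
qed

lemma rho2_nonzero: "z \<in> TB \<Longrightarrow> u \<in> TB \<Longrightarrow> rho2 z u \<noteq> 0"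
  using Re_rho2_pos[of z u] by auto

section \<open>Verification of the kernel assumptions for S and T\<close>

lemma continuous_on_kerS:
  "continuous_on (Om \<times> Om) (\<lambda>y. kerS b1 b2 c1 c2 (fst y) (snd y))"
  unfolding kerS_def case_prod_unfold
  by (intro continuous_intros) (auto simp: Om_def TB_def rho2_nonzero[unfolded TB_def])

lemma continuous_on_kerT:
  "continuous_on (Om \<times> Om) (\<lambda>y. kerT b1 b2 c1 c2 (fst y) (snd y))"
proof -
  \<comment> \<open>The bases stay in the right half-plane, away from the branch cut, so their
    principal powers are continuous.\<close>
  have *: "Re (rho2 z u) \<ge> 0" "rho2 z u \<noteq> 0" if "rho z > 0" "rho u > 0" for z u :: "complex^'a::{finite,linorder}"
    using Re_rho2_pos[of z u] rho2_nonzero[of z u] that by (auto simp: TB_def)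
  show ?thesis
    unfolding kerT_def case_prod_unfold
    by (intro continuous_intros) (auto simp: Om_def TB_def *)
qed

lemma kerS_eq_abs_kernel: "kerS b1 b2 c1 c2 x p = of_real (abs_kernel b1 b2 c1 c2 x p)"
  by (simp add: kerS_def abs_kernel_def case_prod_unfold)

lemma product_kernel_kerS: "product_kernel b1 b2 c1 c2 (kerS b1 b2 c1 c2)"
proof
  fix x0 :: "('a::{finite,linorder}) pt"
  show "\<exists>S f. open S \<and> x0 \<in> S \<and> f \<in> borel_measurable borel \<and> (\<forall>p. cmod (f p) \<le> 1) \<and>
      (\<forall>x\<in>S \<inter> Om. \<forall>p\<in>Om. cmod (kerS b1 b2 c1 c2 x p) \<le> 2 * Re (kerS b1 b2 c1 c2 x p * f p))"
    \<comment> \<open>This kernel is nonnegative, so the constant 1 serves all points at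
      once.\<close>
    by (rule exI[of _ UNIV], rule exI[of _ "\<lambda>_. 1"])
      (auto simp: kerS_eq_abs_kernel abs_kernel_nonneg)
qed (auto simp: norm_kerS continuous_on_kerS)

text \<open>Near x0 the kernel is K x0 times a factor Q built from powers of quotients that are
  close to 1 uniformly in p. Multiplying by the conjugate phase of K x0 leaves |K x0| Q, and Re Q is
  at least |Q|/2.\<close>

lemma product_kernel_kerT: "product_kernel b1 b2 c1 c2 (kerT b1 b2 c1 c2)"
proof
  fix x0 :: "('a::{finite,linorder}) pt"
  assume "x0 \<in> Om"
  obtain z0 w0 where x0: "x0 = (z0, w0)" "z0 \<in> TB" "w0 \<in> TB"
    using \<open>x0 \<in> Om\<close> by (auto simp: Om_def)
  let ?K = "kerT b1 b2 c1 c2"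
  obtain e where e: "e > 0" "\<And>q1 q2. cmod (q1 - 1) < e \<Longrightarrow> cmod (q2 - 1) < e \<Longrightarrow>
    cmod (1 / (q1 powr of_real c1 * q2 powr of_real c2)) \<le> 2 * Re (1 / (q1 powr of_real c1 * q2 powr of_real c2))"
    using Re_powr_product_near_1[of "of_real c1" "of_real c2"] by blast
  obtain d1 where d1: "d1 > 0" "\<And>z u. dist z z0 < d1 \<Longrightarrow> u \<in> TB \<Longrightarrow> cmod (rho2 z u / rho2 z0 u - 1) < e"
    using rho2_quotient_near_1[OF x0(2) e(1)] by blast
  obtain d2 where d2: "d2 > 0" "\<And>z u. dist z w0 < d2 \<Longrightarrow> u \<in> TB \<Longrightarrow> cmod (rho2 z u / rho2 w0 u - 1) < e"
    using rho2_quotient_near_1[OF x0(3) e(1)] by blast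
  \<comment> \<open>The kernel at x0 has no zero on \<open>Om\<close>, so this phase is continuous
    there; extension by 0 keeps it measurable.\<close>
  define f where "f p = indicator Om p *\<^sub>R (cnj (?K x0 p) / of_real (cmod (?K x0 p)))" for p
  have K0: "?K x0 p \<noteq> 0" if "p \<in> Om" for p
    using that x0 by (auto simp: kerT_def Om_def TB_def rho2_nonzero[unfolded TB_def])
  have cont: "continuous_on Om (?K x0)"
  proof -
    have "continuous_on Om (\<lambda>p. (x0, p))" "(\<lambda>p. (x0, p)) ` Om \<subseteq> Om \<times> Om"
      using \<open>x0 \<in> Om\<close> by (auto intro!: continuous_intros)
    from continuous_on_compose2[OF continuous_on_kerT this] show ?thesis by simp
  qed
  have "f \<in> borel_measurable borel"
    unfolding f_def using K0
    by (intro borel_measurable_continuous_on_indicator Om_sets continuous_intros cont) auto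
  moreover have "cmod (f p) \<le> 1" for p
    unfolding f_def by (auto simp: norm_divide split: split_indicator)
  moreover have "cmod (?K x p) \<le> 2 * Re (?K x p * f p)"
    if x: "x \<in> (ball z0 d1 \<times> ball w0 d2) \<inter> Om" and p: "p \<in> Om" for x p
  proof -
    obtain z w where zw: "x = (z, w)" "z \<in> TB" "w \<in> TB" "dist z z0 < d1" "dist w w0 < d2"
      using x by (auto simp: Om_def dist_commute)
    obtain u v where uv: "p = (u, v)" "u \<in> TB" "v \<in> TB"
      using p by (auto simp: Om_def)
    define Q where "Q = 1 / ((rho2 z u / rho2 z0 u) powr of_real c1 * (rho2 w v / rho2 w0 v) powr of_real c2)"
    have Q: "cmod Q \<le> 2 * Re Q"
      unfolding Q_def using zw uv by (intro e(2) d1(2) d2(2))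
    have KQ: "?K x p = ?K x0 p * Q"
      unfolding Q_def zw uv x0 kerT_def
      using zw uv x0 by (simp add: powr_divide_right_half_plane[OF Re_rho2_pos Re_rho2_pos] rho2_nonzero)
    have "?K x p * f p = (?K x0 p * cnj (?K x0 p)) / of_real (cmod (?K x0 p)) * Q"
      unfolding f_def KQ using p by simp
    also have "\<dots> = of_real (cmod (?K x0 p)) * Q"
      using K0[OF p] by (simp add: complex_norm_square[symmetric] power2_eq_square)
    finally have "Re (?K x p * f p) = cmod (?K x0 p) * Re Q"
      by (simp only:) simp
    moreover have "cmod (?K x0 p) * cmod Q \<le> cmod (?K x0 p) * (2 * Re Q)"
      by (intro mult_left_mono Q) auto
    ultimately show ?thesis unfolding KQ norm_mult by simp
  qed
  ultimately show "\<exists>S f. open S \<and> x0 \<in> S \<and> f \<in> borel_measurable borel \<and> (\<forall>p. cmod (f p) \<le> 1) \<and>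
      (\<forall>x\<in>S \<inter> Om. \<forall>p\<in>Om. cmod (?K x p) \<le> 2 * Re (?K x p * f p))"
    using x0 d1(1) d2(1)
    by (intro exI[of _ "ball z0 d1 \<times> ball w0 d2"] exI[of _ f] conjI open_Times) auto
qed (auto simp: norm_kerT continuous_on_kerT)

theorem theorem6p9:
  fixes a1 a2 b1 b2 c1 c2 :: real
  shows "(bounded_Linf (pref a1 a2) (kerS b1 b2 c1 c2 :: ('n::{finite,linorder}) pt \<Rightarrow> 'n pt \<Rightarrow> complex)
            \<longleftrightarrow> bounded_Linf (pref a1 a2) (kerT b1 b2 c1 c2 :: 'n pt \<Rightarrow> 'n pt \<Rightarrow> complex))
       \<and> (bounded_Linf (pref a1 a2) (kerT b1 b2 c1 c2 :: 'n pt \<Rightarrow> 'n pt \<Rightarrow> complex)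
            \<longleftrightarrow> (a1 > 0 \<and> b1 > -1 \<and> c1 = real CARD('n) + 1 + a1 + b1
               \<and> a2 > 0 \<and> b2 > -1 \<and> c2 = real CARD('n) + 1 + a2 + b2))"
  using product_kernel.bounded_if[OF product_kernel_kerS, of _ a1 b1 _ a2 b2]
    product_kernel.bounded_onlyif[OF product_kernel_kerS, of a1 a2 b1 b2 c1 c2]
    product_kernel.bounded_if[OF product_kernel_kerT, of _ a1 b1 _ a2 b2]
    product_kernel.bounded_onlyif[OF product_kernel_kerT, of a1 a2 b1 b2 c1 c2]
  by blast

end
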